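(* Let $G$ be a finite $2$-group of order $2^n$. If $\chi$ is a non-linear irreducible complex character of $G$, then $\chi(g)=0$ for at least $2^{n-1}+2$ elements $g\in G$. Furthermore, there exists $\chi\in\operatorname{Irr}(G)$ that vanishes at exactly $2^{n-1}+2$ elements of $G$ if and only if $G$ is dihedral, semidihedral or generalized quaternion.
   Context: $\operatorname{Irr}(G)$ denotes the set of irreducible complex characters of the finite group $G$. A character $\chi$ is linear if $\chi(1)=1$ and non-linear otherwise; $\chi$ vanishes at $g$ if $\chi(g)=0$. Dihedral, semidihedral and generalized quaternion $2$-groups are understood to be non-abelian: dihedral groups of order $2^n$ with $n\ge 3$, generalized quaternion groups of order $2^n$ with $n\ge 3$ (including the quaternion group of order $8$), and semidihedral groups of order $2^n$ with $n\ge 4$. *)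

theory Defs
  imports
    "HOL-Algebra.Algebra"
    "Jordan_Normal_Form.Matrix"
    "Jordan_Normal_Form.VS_Connect"
begin

section \<open>Complex representations and characters of finite groups\<close>

definition GL :: "nat \<Rightarrow> complex mat monoid" where
  "GL d = units_of (ring_mat TYPE(complex) d ())"

definition representation :: "('a, 'b) monoid_scheme \<Rightarrow> nat \<Rightarrow> ('a \<Rightarrow> complex mat) \<Rightarrow> bool" where
  "representation G d \<rho> \<longleftrightarrow> \<rho> \<in> hom G (GL d)"

definition irreducible_representation ::
    "('a, 'b) monoid_scheme \<Rightarrow> nat \<Rightarrow> ('a \<Rightarrow> complex mat) \<Rightarrow> bool" where
  "irreducible_representation G d \<rho> \<longleftrightarrow>
     representation G d \<rho> \<and> d > 0 \<and>
     (\<forall>W. VectorSpace.subspace class_ring W (module_vec TYPE(complex) d) \<and>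
          (\<forall>g\<in>carrier G. \<forall>w\<in>W. \<rho> g *\<^sub>v w \<in> W)
          \<longrightarrow> W = {0\<^sub>v d} \<or> W = carrier_vec d)"

definition mat_trace :: "complex mat \<Rightarrow> complex" where
  "mat_trace A = (\<Sum>i<dim_row A. A $$ (i, i))"

text \<open>Characters are restricted to the carrier, so that distinct members of \<open>Irr G\<close>
  differ at some element of the group.\<close>

definition Irr :: "('a, 'b) monoid_scheme \<Rightarrow> ('a \<Rightarrow> complex) set" where
  "Irr G = {\<chi>. \<exists>d \<rho>. irreducible_representation G d \<rho> \<and>
                    \<chi> = restrict (\<lambda>g. mat_trace (\<rho> g)) (carrier G)}"

definition linear_character :: "('a, 'b) monoid_scheme \<Rightarrow> ('a \<Rightarrow> complex) \<Rightarrow> bool" where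
  "linear_character G \<chi> \<longleftrightarrow> \<chi> \<one>\<^bsub>G\<^esub> = 1"

definition vanishing_set :: "('a, 'b) monoid_scheme \<Rightarrow> ('a \<Rightarrow> complex) \<Rightarrow> 'a set" where
  "vanishing_set G \<chi> = {g \<in> carrier G. \<chi> g = 0}"


section \<open>Dihedral, semidihedral and generalized quaternion 2-groups\<close>

text \<open>
  Each family is given by its standard presentation with generators \<open>r\<close> and \<open>s\<close>.
  Every group generated by two elements satisfying the relations is a quotient of the presented
  group, whose order is \<open>2 ^ k\<close>; so requiring \<open>order G = 2 ^ k\<close> makes \<open>G\<close> isomorphic
  to it, and in particular \<open>r\<close> has order exactly \<open>2 ^ (k - 1)\<close>.
\<close>

definition dihedral_2_group :: "('a, 'b) monoid_scheme \<Rightarrow> bool" where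
  "dihedral_2_group G \<longleftrightarrow> group G \<and>
     (\<exists>k\<ge>3. Coset.order G = 2 ^ k \<and>
       (\<exists>r\<in>carrier G. \<exists>s\<in>carrier G.
          generate G {r, s} = carrier G \<and>
          r [^]\<^bsub>G\<^esub> (2 ^ (k - 1) :: nat) = \<one>\<^bsub>G\<^esub> \<and>
          s [^]\<^bsub>G\<^esub> (2 :: nat) = \<one>\<^bsub>G\<^esub> \<and>
          s \<otimes>\<^bsub>G\<^esub> r \<otimes>\<^bsub>G\<^esub> inv\<^bsub>G\<^esub> s = inv\<^bsub>G\<^esub> r))"

definition semidihedral_2_group :: "('a, 'b) monoid_scheme \<Rightarrow> bool" where
  "semidihedral_2_group G \<longleftrightarrow> group G \<and>
     (\<exists>k\<ge>4. Coset.order G = 2 ^ k \<and>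
       (\<exists>r\<in>carrier G. \<exists>s\<in>carrier G.
          generate G {r, s} = carrier G \<and>
          r [^]\<^bsub>G\<^esub> (2 ^ (k - 1) :: nat) = \<one>\<^bsub>G\<^esub> \<and>
          s [^]\<^bsub>G\<^esub> (2 :: nat) = \<one>\<^bsub>G\<^esub> \<and>
          s \<otimes>\<^bsub>G\<^esub> r \<otimes>\<^bsub>G\<^esub> inv\<^bsub>G\<^esub> s = r [^]\<^bsub>G\<^esub> (2 ^ (k - 2) - 1 :: nat)))"

definition generalized_quaternion_group :: "('a, 'b) monoid_scheme \<Rightarrow> bool" where
  "generalized_quaternion_group G \<longleftrightarrow> group G \<and>
     (\<exists>k\<ge>3. Coset.order G = 2 ^ k \<and>
       (\<exists>r\<in>carrier G. \<exists>s\<in>carrier G.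
          generate G {r, s} = carrier G \<and>
          r [^]\<^bsub>G\<^esub> (2 ^ (k - 1) :: nat) = \<one>\<^bsub>G\<^esub> \<and>
          s [^]\<^bsub>G\<^esub> (2 :: nat) = r [^]\<^bsub>G\<^esub> (2 ^ (k - 2) :: nat) \<and>
          s \<otimes>\<^bsub>G\<^esub> r \<otimes>\<^bsub>G\<^esub> inv\<^bsub>G\<^esub> s = inv\<^bsub>G\<^esub> r))"

end

theory Submission
  imports Defs "Jordan_Normal_Form.Spectral_Radius"
begin

text \<open>
  Let \<open>\<rho>\<close> be an irreducible representation of degree above one of a \<open>2\<close>-group \<open>G\<close>. Zeros of its
  character are produced by a sign: if \<open>z\<close> acts as \<open>-1\<close> and \<open>g\<close> is conjugate to \<open>z \<otimes> g\<close>, then the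
  trace of \<open>g\<close> equals its own negative. Bounding the number of zeros from below
  thereby becomes a question about conjugacy in the group alone.

  Assume first that \<open>\<rho>\<close> is faithful. By Schur's lemma central elements are scalars, so there is
  exactly one central involution \<open>z\<close>, and it acts as \<open>-1\<close>. Counting orbits of conjugation on
  cosets (\<open>two_group_central_mod_normal\<close>) gives a noncentral \<open>a\<close> that is central modulo the center
  and whose square is central. The conjugates of \<open>a\<close> are then \<open>a\<close> and \<open>z \<otimes> a\<close>, so its centralizer
  \<open>M\<close> has index two, and each \<open>g\<close> outside \<open>M\<close> is conjugate to \<open>z \<otimes> g\<close> by means of \<open>a\<close>. This
  accounts for \<open>2 ^ (n - 1)\<close> zeros; \<open>a\<close> and \<open>z \<otimes> a\<close> are two more.

  For the case of equality, the same argument is repeated inside \<open>M\<close>. If \<open>M\<close> is not abelian, it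
  contains at least four such elements (\<open>nonabelian_index_two_case\<close>). If \<open>M\<close> is abelian, all
  products of \<open>a\<close> with central elements are zeros, so equality forces the center to have order two.
  Conjugation by an element outside \<open>M\<close> then maps each \<open>x\<close> in \<open>M\<close> to \<open>inv x\<close> or \<open>z \<otimes> inv x\<close>,
  which leaves only the dihedral, semidihedral and generalized quaternion groups
  (\<open>dihedral_type_if_center_two\<close>).

  A representation with kernel of order \<open>k\<close> is compared with the inclusion of its image: numbers of
  elements are multiplied by \<open>k\<close>, which turns the excess \<open>2\<close> into \<open>2 * k\<close>. So equality can occur
  only for faithful representations (\<open>zeros_of_nonlinear\<close>).

  Conversely, each group in the three families has a cyclic subgroup of index two, and the character
  induced from a faithful linear character of that subgroup attains the bound
  (\<open>exists_irr_with_few_zeros\<close>).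
\<close>

section \<open>Central involutions modulo a normal subgroup\<close>

lemma (in group) finite_carrier_of_order_two_power:
  assumes "Coset.order G = 2 ^ n"
  shows "finite (carrier G)"
proof -
  have "card (carrier G) > 0" using assms by (simp add: Coset.order_def)
  then show ?thesis by (rule card_ge_0_finite)
qed

lemma dvd_two_power_even:
  fixes m k :: nat
  assumes "m dvd 2 ^ k" and "m \<noteq> 1"
  shows "even m"
proof -
  obtain j where "m = 2 ^ j"
    using assms(1) by (auto simp: divides_primepow_nat)
  with assms(2) show ?thesis by (cases j) auto
qed

text \<open>
  A finite \<open>2\<close>-group acts by conjugation on the cosets of \<open>N\<close> that lie in \<open>L\<close>. Their number
  is even and the orbits have sizes that are powers of two; since the coset \<open>N\<close> itself is fixed,
  another coset \<open>N #> x\<close> is fixed as well, and a suitable power of \<open>x\<close> has its square in \<open>N\<close>.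
  In other words, \<open>L\<close> modulo \<open>N\<close> contains an involution that is central in \<open>G\<close> modulo \<open>N\<close>.
\<close>

lemma (in group) two_group_central_mod_normal:
  assumes ord: "Coset.order G = 2 ^ n"
    and N: "N \<lhd> G" and L: "L \<lhd> G" and NL: "N \<subset> L"
  shows "\<exists>b\<in>L - N. b \<otimes> b \<in> N \<and> (\<forall>g\<in>carrier G. \<exists>u\<in>N. g \<otimes> b = u \<otimes> b \<otimes> g)"
proof -
  have fin: "finite (carrier G)" by (rule finite_carrier_of_order_two_power[OF ord])
  interpret N: normal N G by fact
  interpret L: normal L G by fact
  have Nc: "N \<subseteq> carrier G" and Lc: "L \<subseteq> carrier G"
    using N.subset L.subset by auto
  have conj_coset: "g <# (N #> x) #> inv g = N #> (g \<otimes> x \<otimes> inv g)"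
    if "g \<in> carrier G" "x \<in> carrier G" for g x
  proof -
    have "g <# (N #> x) = (g <# N) #> x" using that Nc by (simp add: coset_assoc)
    also have "\<dots> = (N #> g) #> x" using N.coset_eq that by simp
    also have "\<dots> = N #> (g \<otimes> x)" using that Nc by (simp add: coset_mult_assoc)
    finally have "g <# (N #> x) = N #> (g \<otimes> x)" .
    then show ?thesis using that Nc by (simp add: coset_mult_assoc)
  qed
  have same_coset: "\<exists>u\<in>N. y = u \<otimes> x"
    if "x \<in> carrier G" "y \<in> carrier G" "N #> y = N #> x" for x y
    using that rcos_self[OF that(2) N.subgroup_axioms] by (auto simp: r_coset_def)
  define E where "E = (\<lambda>x. N #> x) ` (L - N)"
  define \<phi> where "\<phi> = (\<lambda>g. \<lambda>H\<in>{H. H \<subseteq> carrier G}. g <# H #> inv g)"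
  interpret A: group_action G "{H. H \<subseteq> carrier G}" \<phi>
    unfolding \<phi>_def by (rule action_by_conjugation_on_power_set)
  have E_sub: "E \<subseteq> {H. H \<subseteq> carrier G}"
    unfolding E_def using Lc r_coset_subset_G[OF Nc] by blast
  have act: "\<phi> g (N #> x) = N #> (g \<otimes> x \<otimes> inv g)" if "g \<in> carrier G" "x \<in> carrier G" for g x
    using that conj_coset r_coset_subset_G[OF Nc] by (simp add: \<phi>_def)
  have conj_mem: "g \<otimes> x \<otimes> inv g \<in> L - N" if "g \<in> carrier G" "x \<in> L - N" for g x
  proof -
    have x: "x \<in> carrier G" using that Lc by auto
    have "g \<otimes> x \<otimes> inv g \<in> L" using that L.inv_op_closed2 by auto
    moreover have "x = inv g \<otimes> (g \<otimes> x \<otimes> inv g) \<otimes> g"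
      using that x by (simp add: m_assoc[symmetric]) (simp add: m_assoc)
    moreover have "g \<otimes> x \<otimes> inv g \<notin> N"
      using N.inv_op_closed1[OF that(1), of "g \<otimes> x \<otimes> inv g"] calculation(2) that by auto
    ultimately show ?thesis by blast
  qed
  have orb_sub: "orbit G \<phi> B \<subseteq> E" if B: "B \<in> E" for B
  proof
    fix Y assume "Y \<in> orbit G \<phi> B"
    then obtain g x where "g \<in> carrier G" "x \<in> L - N" "Y = \<phi> g (N #> x)"
      using B by (auto simp: orbit_def E_def)
    then have "Y = N #> (g \<otimes> x \<otimes> inv g)" and "g \<otimes> x \<otimes> inv g \<in> L - N"
      using act conj_mem Lc by blast+
    then show "Y \<in> E" by (auto simp: E_def)
  qed
  have orb_self: "B \<in> orbit G \<phi> B" if "B \<in> E" for B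
    using A.orbit_refl that E_sub by auto
  have orb_Un: "\<Union> (orbit G \<phi> ` E) = E" using orb_sub orb_self by blast
  have finL: "finite L" using fin Lc finite_subset by blast
  then have finE: "finite E" by (simp add: E_def)
  \<comment> \<open>The cosets in \<open>E\<close> together with \<open>N\<close> itself are counted by the index of \<open>N\<close> in \<open>L\<close>.\<close>
  have odd_E: "odd (card E)"
  proof -
    interpret LG: group "G\<lparr>carrier := L\<rparr>" by (rule L.subgroup_is_group[OF is_group])
    have NsubL: "subgroup N (G\<lparr>carrier := L\<rparr>)"
      using NL N.subgroup_axioms L.subgroup_axioms subgroup_incl by blast
    have rc: "rcosets\<^bsub>G\<lparr>carrier := L\<rparr>\<^esub> N = insert N E"
    proof -
      have N_coset: "N #> x = N" if "x \<in> N" for x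
        using that coset_join2[OF _ N.subgroup_axioms] Nc by blast
      have "N #>\<^bsub>G\<lparr>carrier := L\<rparr>\<^esub> x = N #> x" for x by (simp add: r_coset_def)
      then have "RCOSETS (G\<lparr>carrier := L\<rparr>) N = (\<lambda>x. N #> x) ` L"
        by (simp add: RCOSETS_def image_def Bex_def) blast
      also have "\<dots> = (\<lambda>x. N #> x) ` (N \<union> (L - N))"
        using NL by (intro arg_cong[where f = "image _"]) blast
      also have "(\<lambda>x. N #> x) ` (N \<union> (L - N)) = (\<lambda>x. N #> x) ` N \<union> E"
        by (simp only: image_Un E_def)
      also have "(\<lambda>x. N #> x) ` N = {N}" using N_coset N.one_closed by blast
      finally show ?thesis by simp
    qed
    have NE: "N \<notin> E"
    proof
      assume "N \<in> E"
      then obtain x where "x \<in> L - N" "N = N #> x" by (auto simp: E_def)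
      then show False using rcos_self[OF _ N.subgroup_axioms, of x] Lc by auto
    qed
    have lag: "card (insert N E) * card N = card L"
      using LG.lagrange[OF NsubL] unfolding rc by (simp add: Coset.order_def)
    have "card L dvd 2 ^ n"
      using lagrange[OF L.subgroup_axioms] ord by (metis dvd_triv_right)
    then have "card (insert N E) dvd 2 ^ n" using lag by (metis dvd_mult_left)
    moreover have "card (insert N E) \<noteq> 1"
    proof
      assume "card (insert N E) = 1"
      with lag have "card N = card L" by (simp only: mult_1)
      have "card N < card L" using finL NL by (rule psubset_card_mono)
      with \<open>card N = card L\<close> show False by simp
    qed
    ultimately have "even (card (insert N E))" by (rule dvd_two_power_even)
    then show ?thesis using NE finE by simp
  qed
  have "\<exists>B\<in>E. orbit G \<phi> B = {B}"
  proof (rule ccontr)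
    assume no: "\<not> ?thesis"
    have "2 dvd card (\<Union> (orbit G \<phi> ` E))"
    proof (rule dvd_partition)
      show "finite (\<Union> (orbit G \<phi> ` E))" using finE orb_Un by simp
      show "\<forall>c\<in>orbit G \<phi> ` E. 2 dvd card c"
      proof
        fix c assume "c \<in> orbit G \<phi> ` E"
        then obtain B where B: "B \<in> E" "c = orbit G \<phi> B" by auto
        have "card c dvd 2 ^ n"
        proof -
          have "card c * card (stabilizer G \<phi> B) = 2 ^ n"
            using A.orbit_stabilizer_theorem[of B] B E_sub ord by (simp only: subsetD)
          then show ?thesis by (metis dvd_triv_left)
        qed
        moreover have "card c \<noteq> 1"
          using B no orb_self[OF B(1)] by (auto simp: card_1_singleton_iff)
        ultimately show "2 dvd card c" by (rule dvd_two_power_even)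
      qed
      show "\<forall>c1\<in>orbit G \<phi> ` E. \<forall>c2\<in>orbit G \<phi> ` E. c1 \<noteq> c2 \<longrightarrow> c1 \<inter> c2 = {}"
      proof -
        have "orbit G \<phi> B \<in> orbits G {H. H \<subseteq> carrier G} \<phi>" if "B \<in> E" for B
          using that E_sub by (auto simp: orbits_def)
        then show ?thesis using A.disjoint_union by blast
      qed
    qed
    then show False using orb_Un odd_E by simp
  qed
  then obtain x where x: "x \<in> L" "x \<notin> N" and fix_x: "orbit G \<phi> (N #> x) = {N #> x}"
    by (auto simp: E_def)
  have xc: "x \<in> carrier G" using x Lc by auto
  have cent_x: "\<exists>u\<in>N. g \<otimes> x = u \<otimes> x \<otimes> g" if g: "g \<in> carrier G" for g
  proof -
    have "\<phi> g (N #> x) \<in> orbit G \<phi> (N #> x)" using g by (auto simp: orbit_def)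
    then have "\<phi> g (N #> x) = N #> x" using fix_x by simp
    then have "N #> (g \<otimes> x \<otimes> inv g) = N #> x" using act[OF g xc] by (simp only:)
    moreover have "g \<otimes> x \<otimes> inv g \<in> carrier G" using g xc by simp
    ultimately obtain u where u: "u \<in> N" "g \<otimes> x \<otimes> inv g = u \<otimes> x"
      using same_coset[OF xc] by metis
    have "g \<otimes> x = (g \<otimes> x \<otimes> inv g) \<otimes> g" using g xc by (simp add: m_assoc)
    then show ?thesis using u by auto
  qed
  have cent_pow: "\<exists>u\<in>N. g \<otimes> x [^] k = u \<otimes> x [^] k \<otimes> g" if g: "g \<in> carrier G" for g and k :: nat
  proof (induction k)
    case 0
    then show ?case using g by (auto intro!: bexI[of _ \<one>])
  next
    case (Suc k)
    then obtain u where u: "u \<in> N" "g \<otimes> x [^] k = u \<otimes> x [^] k \<otimes> g" by auto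
    obtain v where v: "v \<in> N" "g \<otimes> x = v \<otimes> x \<otimes> g" using cent_x[OF g] by auto
    have c: "u \<in> carrier G" "v \<in> carrier G" "x [^] k \<in> carrier G" using u v Nc xc by auto
    define w where "w = x [^] k \<otimes> v \<otimes> inv (x [^] k)"
    have w: "w \<in> N" using v c by (simp add: w_def N.inv_op_closed2)
    have wc: "w \<in> carrier G" using w Nc by auto
    have wx: "x [^] k \<otimes> v = w \<otimes> x [^] k" using c by (simp add: w_def m_assoc)
    have "g \<otimes> x [^] Suc k = (g \<otimes> x [^] k) \<otimes> x" using g xc c by (simp add: m_assoc)
    also have "\<dots> = u \<otimes> x [^] k \<otimes> (g \<otimes> x)" using u g xc c by (simp add: m_assoc)
    also have "\<dots> = u \<otimes> (x [^] k \<otimes> v) \<otimes> x \<otimes> g" using v g xc c by (simp add: m_assoc)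
    also have "\<dots> = (u \<otimes> w) \<otimes> x [^] Suc k \<otimes> g" using wx wc g xc c by (simp add: m_assoc)
    finally show ?case using u w by blast
  qed
  have "\<exists>j. x [^] (2 ^ j :: nat) \<in> N"
    using pow_order_eq_1[OF xc] ord by (intro exI[of _ n]) simp
  moreover have "x [^] (2 ^ 0 :: nat) \<notin> N" using x xc by simp
  ultimately obtain j where j: "x [^] (2 ^ j :: nat) \<notin> N" "x [^] (2 ^ Suc j :: nat) \<in> N"
    using nat_induct[of "\<lambda>j. x [^] (2 ^ j :: nat) \<notin> N"] by auto
  \<comment> \<open>The last power of \<open>x\<close> outside \<open>N\<close> in the chain of repeated squares.\<close>
  define b where "b = x [^] (2 ^ j :: nat)"
  have "b \<otimes> b = x [^] (2 ^ Suc j :: nat)"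
    unfolding b_def by (simp only: nat_pow_mult[OF xc] power_Suc mult_2)
  then have bN: "b \<otimes> b \<in> N" using j(2) by (simp only:)
  have "x [^] k \<in> L" for k :: nat using x(1) by (induction k) auto
  then have bL: "b \<in> L - N" using j(1) by (simp only: b_def Diff_iff not_False_eq_True simp_thms)
  have "\<forall>g\<in>carrier G. \<exists>u\<in>N. g \<otimes> b = u \<otimes> b \<otimes> g"
    unfolding b_def by (intro ballI cent_pow)
  with bN have "b \<otimes> b \<in> N \<and> (\<forall>g\<in>carrier G. \<exists>u\<in>N. g \<otimes> b = u \<otimes> b \<otimes> g)" by (rule conjI)
  then show ?thesis using bL by (rule bexI)
qed

section \<open>Cyclic subgroups and subgroups of index two\<close>

text \<open>
  On an abelian group, squaring is a homomorphism; here its kernel has at most two elements, so each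
  of its fibres does too, and the bound doubles with each further squaring.
\<close>

lemma (in group) card_two_power_torsion_le:
  assumes fin: "finite (carrier G)" and M: "subgroup M G"
    and comm: "\<And>x y. x \<in> M \<Longrightarrow> y \<in> M \<Longrightarrow> x \<otimes> y = y \<otimes> x"
    and inv2: "\<And>x. x \<in> M \<Longrightarrow> x \<otimes> x = \<one> \<Longrightarrow> x = \<one> \<or> x = z"
  shows "card {x \<in> M. x [^] (2 ^ k :: nat) = \<one>} \<le> 2 ^ k"
proof (induction k)
  interpret M: subgroup M G by fact
  have finM: "finite M" using fin M.subset finite_subset by blast
  {
    case 0
    have "{x \<in> M. x [^] (2 ^ 0 :: nat) = \<one>} \<subseteq> {\<one>}" using M.mem_carrier by auto
    then have "card {x \<in> M. x [^] (2 ^ 0 :: nat) = \<one>} \<le> card {\<one>}" by (intro card_mono) auto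
    then show ?case by simp
  next
    case (Suc k)
    let ?S = "\<lambda>j. {x \<in> M. x [^] (2 ^ j :: nat) = \<one>}"
    \<comment> \<open>Two square roots of \<open>y\<close> differ by an element whose square is trivial.\<close>
    have fibre: "card {x \<in> M. x \<otimes> x = y} \<le> 2" for y
    proof (cases "{x \<in> M. x \<otimes> x = y} = {}")
      case True
      then show ?thesis by (simp only: card.empty)
    next
      case False
      then obtain w where w: "w \<in> M" "w \<otimes> w = y" by auto
      have "x \<in> {w, z \<otimes> w}" if x: "x \<in> M" "x \<otimes> x = y" for x
      proof -
        have c: "x \<in> carrier G" "w \<in> carrier G" using x w M.mem_carrier by auto
        have xw: "x \<otimes> inv w \<in> M" using x w by simp
        have "(x \<otimes> inv w) \<otimes> (x \<otimes> inv w) = (x \<otimes> inv w) \<otimes> (inv w \<otimes> x)"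
          using comm[of x "inv w"] x w by simp
        also have "\<dots> = x \<otimes> inv (w \<otimes> w) \<otimes> x" using c by (simp add: m_assoc inv_mult_group)
        also have "\<dots> = x \<otimes> inv (x \<otimes> x) \<otimes> x" using x w by simp
        also have "\<dots> = \<one>" using c by (simp add: m_assoc inv_mult_group)
        finally have "x \<otimes> inv w = \<one> \<or> x \<otimes> inv w = z" using inv2 xw by blast
        moreover have "x = (x \<otimes> inv w) \<otimes> w" using c by (simp add: m_assoc)
        ultimately show ?thesis using c by auto
      qed
      then have "{x \<in> M. x \<otimes> x = y} \<subseteq> {w, z \<otimes> w}" by blast
      then have "card {x \<in> M. x \<otimes> x = y} \<le> card {w, z \<otimes> w}" by (intro card_mono) auto
      also have "\<dots> \<le> 2" by (simp add: card_insert_if)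
      finally show ?thesis .
    qed
    have "?S (Suc k) \<subseteq> (\<Union>y\<in>?S k. {x \<in> M. x \<otimes> x = y})"
    proof
      fix x assume x: "x \<in> ?S (Suc k)"
      then have xc: "x \<in> carrier G" using M.mem_carrier by auto
      have "(x \<otimes> x) [^] (2 ^ k :: nat) = (x [^] (2::nat)) [^] (2 ^ k :: nat)"
        using xc by (simp add: numeral_2_eq_2)
      also have "\<dots> = x [^] (2 ^ Suc k :: nat)"
        using xc by (simp only: nat_pow_pow power_Suc)
      also have "\<dots> = \<one>" using x by simp
      finally show "x \<in> (\<Union>y\<in>?S k. {x \<in> M. x \<otimes> x = y})" using x by auto
    qed
    then have "card (?S (Suc k)) \<le> card (\<Union>y\<in>?S k. {x \<in> M. x \<otimes> x = y})"
      using finM by (intro card_mono) auto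
    also have "\<dots> \<le> (\<Sum>y\<in>?S k. card {x \<in> M. x \<otimes> x = y})"
      using finM by (intro card_UN_le) auto
    also have "\<dots> \<le> (\<Sum>y\<in>?S k. 2)" using fibre by (intro sum_mono) auto
    also have "\<dots> \<le> 2 ^ Suc k" using Suc.IH by simp
    finally show ?case .
  }
qed

text \<open>
  At most \<open>2 ^ (k - 1)\<close> elements have order dividing \<open>2 ^ (k - 1)\<close>, so some element has order
  \<open>2 ^ k\<close> and generates \<open>M\<close>.
\<close>

lemma (in group) abelian_two_group_one_involution_cyclic:
  assumes fin: "finite (carrier G)" and M: "subgroup M G" and cardM: "card M = 2 ^ k"
    and comm: "\<And>x y. x \<in> M \<Longrightarrow> y \<in> M \<Longrightarrow> x \<otimes> y = y \<otimes> x"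
    and inv2: "\<And>x. x \<in> M \<Longrightarrow> x \<otimes> x = \<one> \<Longrightarrow> x = \<one> \<or> x = z"
  obtains r where "r \<in> M" "ord r = 2 ^ k" "\<And>x. x \<in> M \<Longrightarrow> \<exists>i::nat. x = r [^] i"
proof -
  interpret M: subgroup M G by fact
  have finM: "finite M" using fin M.subset finite_subset by blast
  have exp_dvd: "ord x dvd 2 ^ k" if "x \<in> M" for x
  proof -
    interpret MG: group "G\<lparr>carrier := M\<rparr>" by (rule M.subgroup_is_group[OF is_group])
    have "x [^]\<^bsub>G\<lparr>carrier := M\<rparr>\<^esub> (2 ^ k :: nat) = \<one>"
      using MG.pow_order_eq_1[of x] that cardM by (simp add: Coset.order_def)
    then have "x [^] (2 ^ k :: nat) = \<one>" by (simp add: nat_pow_consistent[symmetric])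
    then show ?thesis using that M.mem_carrier pow_eq_id by blast
  qed
  obtain r where r: "r \<in> M" "ord r = 2 ^ k"
  proof (cases k)
    case 0
    then show ?thesis using that[of \<one>] by simp
  next
    case (Suc j)
    have "\<exists>r\<in>M. r [^] (2 ^ j :: nat) \<noteq> \<one>"
    proof (rule ccontr)
      assume "\<not> ?thesis"
      then have "{x \<in> M. x [^] (2 ^ j :: nat) = \<one>} = M" by auto
      then have "card M \<le> 2 ^ j"
        using card_two_power_torsion_le[OF fin M comm inv2, of j] by (simp only:)
      then show False using cardM Suc by simp
    qed
    then obtain r where r: "r \<in> M" "r [^] (2 ^ j :: nat) \<noteq> \<one>" by auto
    obtain i where i: "i \<le> k" "ord r = 2 ^ i"
      using exp_dvd[OF r(1)] divides_primepow_nat[OF two_is_prime_nat] by metis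
    have "\<not> ord r dvd 2 ^ j" using r M.mem_carrier pow_eq_id by blast
    then have "\<not> i \<le> j" using i le_imp_power_dvd by auto
    then have "i = k" using i(1) Suc by simp
    with i r that show ?thesis by blast
  qed
  have rc: "r \<in> carrier G" using r M.mem_carrier by auto
  have "generate G {r} = M"
  proof (rule card_subset_eq[OF finM])
    show "generate G {r} \<subseteq> M" using generate_subgroup_incl[OF _ M] r by auto
    show "card (generate G {r}) = card M"
      using generate_pow_card[OF rc] r cardM by simp
  qed
  moreover have "generate G {r} = {r [^] i |i. i \<in> (UNIV :: nat set)}"
    using generate_pow_nat[OF rc] r by simp
  ultimately have "\<exists>i::nat. x = r [^] i" if "x \<in> M" for x using that by auto
  with r that show thesis by blast
qed

text \<open>
  Index two is expressed through a chosen element \<open>t\<close> outside \<open>M\<close>: the whole group is the union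
  of \<open>M\<close> and \<open>M #> t\<close>. This form is the one that is checked directly for centralizers and for
  presented groups, and it provides the element that conjugates \<open>M\<close>.
\<close>

locale index_two_subgroup = group G + M: subgroup M G for G (structure) and M +
  fixes t
  assumes t_closed [simp]: "t \<in> carrier G"
    and t_notin: "t \<notin> M"
    and cover: "g \<in> carrier G \<Longrightarrow> g \<in> M \<or> g \<otimes> inv t \<in> M"
begin

lemma mem_mult_iff: "x \<in> M \<Longrightarrow> y \<in> carrier G \<Longrightarrow> x \<otimes> y \<in> M \<longleftrightarrow> y \<in> M"
proof -
  assume x: "x \<in> M" and y: "y \<in> carrier G"
  have "y = inv x \<otimes> (x \<otimes> y)" using x y M.mem_carrier by (simp add: m_assoc[symmetric])
  then show "x \<otimes> y \<in> M \<longleftrightarrow> y \<in> M" using x by (metis M.m_closed M.m_inv_closed)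
qed

lemma outside_inv: "x \<in> carrier G \<Longrightarrow> x \<notin> M \<Longrightarrow> inv x \<notin> M"
  using M.m_inv_closed inv_inv by fastforce

lemma outside_mult:
  assumes "x \<in> carrier G" "x \<notin> M" "y \<in> carrier G" "y \<notin> M"
  shows "x \<otimes> y \<in> M"
proof -
  have "x \<otimes> inv t \<in> M" "inv y \<otimes> inv t \<in> M"
    using cover[of x] cover[of "inv y"] outside_inv assms by auto
  then have "(x \<otimes> inv t) \<otimes> inv (inv y \<otimes> inv t) \<in> M" by blast
  also have "(x \<otimes> inv t) \<otimes> inv (inv y \<otimes> inv t) = x \<otimes> y"
    using assms by (simp add: inv_mult_group m_assoc) (simp add: m_assoc[symmetric])
  finally show ?thesis .
qed

lemma mult_mem_iff:
  assumes "x \<in> carrier G" "y \<in> carrier G"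
  shows "x \<otimes> y \<in> M \<longleftrightarrow> (x \<in> M \<longleftrightarrow> y \<in> M)"
proof (cases "x \<in> M")
  case True
  then show ?thesis using assms mem_mult_iff by simp
next
  case False
  moreover have "x \<otimes> y \<notin> M" if "y \<in> M"
  proof
    assume "x \<otimes> y \<in> M"
    then have "x \<otimes> y \<otimes> inv y \<in> M" using that by blast
    then show False using False assms by (simp add: m_assoc)
  qed
  ultimately show ?thesis using assms outside_mult by blast
qed

lemma inv_mem_iff: "x \<in> carrier G \<Longrightarrow> inv x \<in> M \<longleftrightarrow> x \<in> M"
  using outside_inv by blast

lemma normal: "M \<lhd> G"
  using M.subgroup_axioms M.mem_carrier
  by (intro normal_invI) (auto simp: mult_mem_iff inv_mem_iff)

lemma card_outside:
  assumes "Coset.order G = 2 ^ n"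
  shows "card M = 2 ^ (n - 1)" and "card (carrier G - M) = 2 ^ (n - 1)" and "n \<ge> 1"
proof -
  have fin: "finite (carrier G)" by (rule finite_carrier_of_order_two_power[OF assms])
  have finM: "finite M" using fin M.subset finite_subset by blast
  have "bij_betw (\<lambda>x. t \<otimes> x) M (carrier G - M)"
  proof (rule bij_betwI[where g = "\<lambda>x. inv t \<otimes> x"])
    show "(\<lambda>x. t \<otimes> x) \<in> M \<rightarrow> carrier G - M" using t_notin M.mem_carrier by (auto simp: mult_mem_iff)
    show "(\<lambda>x. inv t \<otimes> x) \<in> carrier G - M \<rightarrow> M"
      using t_notin by (auto simp: mult_mem_iff inv_mem_iff)
  qed (auto simp: m_assoc[symmetric] M.mem_carrier)
  then have eq: "card (carrier G - M) = card M" by (simp add: bij_betw_same_card)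
  have "card (carrier G) = card (M \<union> (carrier G - M))" using M.subset by (simp add: Un_absorb1)
  also have "\<dots> = card M + card (carrier G - M)" using fin finM by (intro card_Un_disjoint) auto
  finally have two: "2 ^ n = 2 * card M" using eq assms by (simp add: Coset.order_def)
  show n: "n \<ge> 1" using two by (cases n) auto
  then show "card M = 2 ^ (n - 1)" using two by (cases n) auto
  then show "card (carrier G - M) = 2 ^ (n - 1)" using eq by simp
qed

lemma generate_all:
  assumes "M \<subseteq> generate G A" and "A \<subseteq> carrier G" and "s \<in> A" "s \<notin> M"
  shows "generate G A = carrier G"
proof -
  interpret A: subgroup "generate G A" G using assms(2) by (rule generate_is_subgroup)
  have s: "s \<in> generate G A" "s \<in> carrier G" using assms by (auto intro: generate.incl)
  have "g \<in> generate G A" if g: "g \<in> carrier G" for g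
  proof (cases "g \<in> M")
    case False
    then have "g \<otimes> inv s \<in> M" using g s assms by (simp add: mult_mem_iff inv_mem_iff)
    then have "g \<otimes> inv s \<otimes> s \<in> generate G A" using assms(1) s by blast
    then show ?thesis using g s by (simp add: m_assoc)
  qed (use assms in auto)
  then show ?thesis using A.subset by blast
qed

end

section \<open>Recognising dihedral, semidihedral and quaternion groups\<close>

context index_two_subgroup
begin

text \<open>
  The three families, recognised from a cyclic subgroup of index two with generator \<open>r\<close>. Here \<open>z\<close>
  is the involution of that subgroup. If \<open>t\<close> inverts \<open>r\<close>, the value of \<open>t \<otimes> t\<close> separates the
  dihedral from the quaternion case. If \<open>t\<close> maps \<open>r\<close> to \<open>z \<otimes> inv r\<close>, the group is semidihedral
  for either value of \<open>t \<otimes> t\<close>: should \<open>t \<otimes> t\<close> be \<open>z\<close>, then \<open>t \<otimes> r\<close> squares to \<open>\<one>\<close> and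
  acts on \<open>r\<close> in the same way as \<open>t\<close>.
\<close>

lemma dihedral_type_if_cyclic:
  assumes ordG: "Coset.order G = 2 ^ n" and n: "n \<ge> 3"
    and r: "r \<in> M" "ord r = 2 ^ (n - 1)" and pow: "\<And>x. x \<in> M \<Longrightarrow> \<exists>i::nat. x = r [^] i"
    and z: "z = r [^] (2 ^ (n - 2) :: nat)"
    and tt: "t \<otimes> t \<in> {\<one>, z}"
    and act: "t \<otimes> r \<otimes> inv t = inv r \<or> n \<ge> 4 \<and> t \<otimes> r \<otimes> inv t = z \<otimes> inv r"
  shows "dihedral_2_group G \<or> semidihedral_2_group G \<or> generalized_quaternion_group G"
proof -
  have rc [simp]: "r \<in> carrier G" using r by simp
  have gen: "generate G {r, s} = carrier G" if "s \<in> carrier G" "s \<notin> M" for s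
  proof (rule generate_all)
    show "M \<subseteq> generate G {r, s}"
    proof
      fix x assume "x \<in> M"
      then obtain i :: nat where x: "x = r [^] i" using pow by blast
      have "subgroup (generate G {r, s}) G" using that by (intro generate_is_subgroup) auto
      moreover have "r \<in> generate G {r, s}" by (simp add: generate.incl)
      ultimately have "r [^] k \<in> generate G {r, s}" for k :: nat
        by (induction k) (auto simp: subgroup.one_closed subgroup.m_closed)
      then show "x \<in> generate G {r, s}" using x by blast
    qed
  qed (use that in auto)
  have r_pow: "r [^] (2 ^ (n - 1) :: nat) = \<one>" using r pow_ord_eq_1[OF rc] by simp
  have zc [simp]: "z \<in> carrier G" by (simp add: z)
  have "z \<otimes> z = r [^] (2 ^ (n - 2) + 2 ^ (n - 2) :: nat)" by (simp add: z nat_pow_mult)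
  also have "(2 ^ (n - 2) + 2 ^ (n - 2) :: nat) = 2 ^ (n - 1)"
    using n by (simp add: mult_2[symmetric] power_Suc[symmetric] Suc_diff_Suc numeral_2_eq_2 del: power_Suc)
  finally have zz: "z \<otimes> z = \<one>" using r_pow by simp
  have sq: "x [^] (2::nat) = x \<otimes> x" if "x \<in> carrier G" for x
    using that by (simp add: numeral_2_eq_2)
  have exponent: "z \<otimes> inv r = r [^] (2 ^ (n - 2) - 1 :: nat)"
  proof -
    have "Suc (2 ^ (n - 2) - 1) = (2 ^ (n - 2) :: nat)" by simp
    then have "r [^] (2 ^ (n - 2) - 1 :: nat) \<otimes> r = z" unfolding z by (metis nat_pow_Suc)
    then have "z \<otimes> inv r = (r [^] (2 ^ (n - 2) - 1 :: nat) \<otimes> r) \<otimes> inv r" by simp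
    then show ?thesis by (simp add: m_assoc)
  qed
  consider (D) "t \<otimes> r \<otimes> inv t = inv r" "t \<otimes> t = \<one>"
    | (Q) "t \<otimes> r \<otimes> inv t = inv r" "t \<otimes> t = z"
    | (S1) "n \<ge> 4" "t \<otimes> r \<otimes> inv t = z \<otimes> inv r" "t \<otimes> t = \<one>"
    | (S2) "n \<ge> 4" "t \<otimes> r \<otimes> inv t = z \<otimes> inv r" "t \<otimes> t = z"
    using tt act by blast
  then show ?thesis
  proof cases
    case D
    then have "dihedral_2_group G"
      unfolding dihedral_2_group_def using is_group ordG n r_pow gen[OF t_closed t_notin] sq[OF t_closed] rc t_closed
      by metis
    then show ?thesis ..
  next
    case Q
    then have "generalized_quaternion_group G"
      unfolding generalized_quaternion_group_def
      using is_group ordG n r_pow gen[OF t_closed t_notin] sq[OF t_closed] rc t_closed z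
      by metis
    then show ?thesis by blast
  next
    case S1
    then have "semidihedral_2_group G"
      unfolding semidihedral_2_group_def
      using S1 exponent is_group ordG r_pow gen[OF t_closed t_notin] sq[OF t_closed] rc t_closed
      by metis
    then show ?thesis by blast
  next
    case S2
    define s where "s = t \<otimes> r"
    have s: "s \<in> carrier G" "s \<notin> M" using r t_notin by (auto simp: s_def mult_mem_iff)
    have tr: "t \<otimes> r = z \<otimes> inv r \<otimes> t"
    proof -
      have "t \<otimes> r = (t \<otimes> r \<otimes> inv t) \<otimes> t" by (simp add: m_assoc)
      then show ?thesis using S2 by simp
    qed
    have "s \<otimes> s = (z \<otimes> inv r \<otimes> t) \<otimes> (t \<otimes> r)" using tr by (simp add: s_def)
    also have "\<dots> = z \<otimes> inv r \<otimes> (t \<otimes> t) \<otimes> r" by (simp add: m_assoc)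
    also have "\<dots> = z \<otimes> (inv r \<otimes> z) \<otimes> r" using S2 by (simp add: m_assoc)
    also have "inv r \<otimes> z = z \<otimes> inv r"
    proof -
      have "r \<otimes> z = z \<otimes> r" by (simp add: z nat_pow_comm[of r 1, simplified] pow_mult_distrib flip: nat_pow_Suc2)
      then show ?thesis by (metis inv_closed inv_solve_left' inv_solve_right m_assoc m_closed rc zc)
    qed
    also have "z \<otimes> (z \<otimes> inv r) \<otimes> r = \<one>" using zz by (simp add: m_assoc)
    finally have ss: "s [^] (2::nat) = \<one>" using sq[OF s(1)] by simp
    have "s \<otimes> r \<otimes> inv s = t \<otimes> r \<otimes> inv t"
      by (simp add: s_def inv_mult_group m_assoc) (simp add: m_assoc[symmetric])
    then have "s \<otimes> r \<otimes> inv s = r [^] (2 ^ (n - 2) - 1 :: nat)" using exponent S2 by simp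
    then have "semidihedral_2_group G"
      unfolding semidihedral_2_group_def
      using S2(1) is_group ordG r_pow gen[OF s] ss rc s by metis
    then show ?thesis by blast
  qed
qed

text \<open>
  The dihedral group of order \<open>8\<close> also has Klein four-subgroups of index two, so this case has to
  be recognised separately: one of \<open>t\<close> and \<open>t \<otimes> x\<close> has order four and serves as the rotation,
  with \<open>x\<close> as the reflection.
\<close>

lemma dihedral_if_klein_four:
  assumes ordG: "Coset.order G = 2 ^ 3"
    and x: "x \<in> M" "x \<otimes> x = \<one>" and z: "z \<in> M" "z \<otimes> z = \<one>"
    and M: "M \<subseteq> {\<one>, z, x, z \<otimes> x}"
    and zt: "t \<otimes> z = z \<otimes> t" and zx: "x \<otimes> z = z \<otimes> x"
    and tt: "t \<otimes> t \<in> {\<one>, z}" and tx: "t \<otimes> x = z \<otimes> x \<otimes> t"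
  shows "dihedral_2_group G"
proof -
  have c [simp]: "x \<in> carrier G" "z \<in> carrier G" using x z by auto
  have sq: "y [^] (2::nat) = y \<otimes> y" if "y \<in> carrier G" for y
    using that by (simp add: numeral_2_eq_2)
  have z_cancel: "z \<otimes> (z \<otimes> y) = y" if "y \<in> carrier G" for y
    using that z by (simp add: m_assoc[symmetric])
  have x_cancel: "x \<otimes> (x \<otimes> y) = y" if "y \<in> carrier G" for y
    using that x by (simp add: m_assoc[symmetric])
  have xt: "x \<otimes> t = z \<otimes> (t \<otimes> x)" using tx z_cancel by (simp add: m_assoc)
  have "\<exists>r\<in>carrier G - M. r \<otimes> r = z \<and> x \<otimes> r = z \<otimes> r \<otimes> x"
  proof (cases "t \<otimes> t = z")
    case True
    then show ?thesis using xt t_notin by (intro bexI[of _ t]) (auto simp: m_assoc)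
  next
    case False
    then have tt1: "t \<otimes> t = \<one>" using tt by blast
    have "(t \<otimes> x) \<otimes> (t \<otimes> x) = z \<otimes> x \<otimes> t \<otimes> (t \<otimes> x)" using tx by simp
    also have "\<dots> = z \<otimes> x \<otimes> ((t \<otimes> t) \<otimes> x)" by (simp add: m_assoc)
    also have "\<dots> = z" using tt1 x by (simp add: m_assoc)
    finally have "(t \<otimes> x) \<otimes> (t \<otimes> x) = z" .
    moreover have "x \<otimes> (t \<otimes> x) = z \<otimes> (t \<otimes> x) \<otimes> x"
      using xt by (simp add: m_assoc[symmetric])
    moreover have "t \<otimes> x \<in> carrier G - M" using x t_notin by (simp add: mult_mem_iff)
    ultimately show ?thesis by blast
  qed
  then obtain r where r: "r \<in> carrier G" "r \<notin> M" "r \<otimes> r = z" "x \<otimes> r = z \<otimes> r \<otimes> x" by blast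
  have "generate G {r, x} = carrier G"
  proof (rule generate_all)
    have sub: "subgroup (generate G {r, x}) G" using r by (intro generate_is_subgroup) auto
    have rx: "r \<in> generate G {r, x}" "x \<in> generate G {r, x}" by (auto intro: generate.incl)
    have z': "z \<in> generate G {r, x}" using subgroup.m_closed[OF sub rx(1) rx(1)] r by simp
    show "M \<subseteq> generate G {r, x}"
      using M rx z' subgroup.one_closed[OF sub] subgroup.m_closed[OF sub z' rx(2)] by blast
  qed (use r in auto)
  moreover have "r [^] (2 ^ (3 - 1) :: nat) = \<one>"
  proof -
    have "r [^] (2 ^ (3 - 1) :: nat) = (r [^] (2::nat)) [^] (2::nat)"
      using r(1) by (simp add: nat_pow_pow)
    also have "\<dots> = \<one>" using r z sq by simp
    finally show ?thesis .
  qed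
  moreover have "x [^] (2::nat) = \<one>" using x sq by simp
  moreover have "x \<otimes> r \<otimes> inv x = inv r"
  proof -
    have "x \<otimes> r \<otimes> inv x = z \<otimes> r" using r by (simp add: m_assoc)
    moreover have "(z \<otimes> r) \<otimes> r = \<one>" using r z by (simp add: m_assoc)
    then have "inv r = z \<otimes> r" using r by (metis c(2) inv_equality m_closed)
    ultimately show ?thesis by simp
  qed
  ultimately show ?thesis
    unfolding dihedral_2_group_def using is_group ordG r(1) c(1) by (metis order_refl)
qed

end

context index_two_subgroup
begin

text \<open>
  An abelian subgroup \<open>M\<close> of index two forces the dihedral types as soon as the center has only two
  elements. Let \<open>c\<close> be conjugation by \<open>t\<close>, an involutory automorphism of \<open>M\<close> whose fixed points
  are central. As \<open>x \<otimes> c x\<close> is always fixed, \<open>c x\<close> is \<open>inv x\<close> or \<open>z \<otimes> inv x\<close> for every \<open>x\<close>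
  in \<open>M\<close>. If \<open>z\<close> is the only involution of \<open>M\<close>, then \<open>M\<close> is cyclic and the previous
  recognition applies. A further involution in \<open>M\<close> prevents \<open>z\<close> from being a square; as \<open>c\<close>
  inverts all squares, \<open>M\<close> then has exponent two, and the action of \<open>c\<close> bounds its order by four.
\<close>

lemma dihedral_type_if_center_two:
  assumes ordG: "Coset.order G = 2 ^ n"
    and abel: "\<And>x y. x \<in> M \<Longrightarrow> y \<in> M \<Longrightarrow> x \<otimes> y = y \<otimes> x"
    and z: "z \<in> M" "z \<noteq> \<one>"
    and center: "{x \<in> carrier G. \<forall>g\<in>carrier G. x \<otimes> g = g \<otimes> x} = {\<one>, z}"
  shows "dihedral_2_group G \<or> semidihedral_2_group G \<or> generalized_quaternion_group G"
proof -
  have fin: "finite (carrier G)" by (rule finite_carrier_of_order_two_power[OF ordG])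
  have cardM: "card M = 2 ^ (n - 1)" and n1: "n \<ge> 1" using card_outside[OF ordG] by auto
  have zc [simp]: "z \<in> carrier G" using z by simp
  have z_comm: "z \<otimes> g = g \<otimes> z" if "g \<in> carrier G" for g
    using center that by blast
  have Mc [simp]: "x \<in> carrier G" if "x \<in> M" for x using that by simp
  define c where "c = (\<lambda>x. t \<otimes> x \<otimes> inv t)"
  have cc [simp]: "c x \<in> carrier G" if "x \<in> carrier G" for x using that by (simp add: c_def)
  have cM [simp]: "c x \<in> M" if "x \<in> M" for x using that t_notin by (simp add: c_def mult_mem_iff inv_mem_iff)
  have c_mult: "c (x \<otimes> y) = c x \<otimes> c y" if "x \<in> carrier G" "y \<in> carrier G" for x y
    using that by (simp add: c_def m_assoc) (simp add: m_assoc[symmetric])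
  have c_t: "t \<otimes> x = c x \<otimes> t" if "x \<in> carrier G" for x
    using that by (simp add: c_def m_assoc)
  have tt: "t \<otimes> t \<in> M" using t_notin by (simp add: mult_mem_iff)
  have c_c: "c (c x) = x" if x: "x \<in> M" for x
  proof -
    have "c (c x) = (t \<otimes> t) \<otimes> x \<otimes> inv (t \<otimes> t)" using x by (simp add: c_def m_assoc inv_mult_group)
    also have "\<dots> = x \<otimes> (t \<otimes> t) \<otimes> inv (t \<otimes> t)" using abel[OF tt x] by simp
    finally show ?thesis using x by (simp add: m_assoc)
  qed
  have fixed: "x \<in> {\<one>, z}" if x: "x \<in> M" "c x = x" for x
  proof -
    have "x \<otimes> g = g \<otimes> x" if g: "g \<in> carrier G" for g
    proof (cases "g \<in> M")
      case True
      then show ?thesis using abel x by simp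
    next
      case False
      define m where "m = g \<otimes> inv t"
      have m: "m \<in> M" using cover[OF g] False by (simp add: m_def)
      have gm: "g = m \<otimes> t" using g by (simp add: m_def m_assoc)
      have "x \<otimes> g = m \<otimes> x \<otimes> t" using abel[OF x(1) m] x m by (simp add: gm m_assoc[symmetric])
      also have "\<dots> = m \<otimes> (t \<otimes> x)" using c_t[of x] x m by (simp add: m_assoc)
      finally show ?thesis using x m by (simp add: gm m_assoc)
    qed
    then have "x \<in> {x \<in> carrier G. \<forall>g\<in>carrier G. x \<otimes> g = g \<otimes> x}" using x by simp
    then show ?thesis by (simp only: center)
  qed
  have "t \<otimes> z \<otimes> inv t = z \<otimes> t \<otimes> inv t" using z_comm[of t] by simp
  then have c_z: "c z = z" by (simp add: c_def m_assoc)
  have zz: "z \<otimes> z = \<one>"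
  proof -
    have "z \<otimes> z \<in> {\<one>, z}" using fixed[of "z \<otimes> z"] z c_z by (simp add: c_mult)
    then show ?thesis using z r_cancel_one by auto
  qed
  have z_cancel: "z \<otimes> (z \<otimes> y) = y" if "y \<in> carrier G" for y
    using that zz by (simp add: m_assoc[symmetric])
  have z_square: "(z \<otimes> y) \<otimes> (z \<otimes> y) = y \<otimes> y" if y: "y \<in> carrier G" for y
  proof -
    have "(z \<otimes> y) \<otimes> (z \<otimes> y) = z \<otimes> ((y \<otimes> z) \<otimes> y)" using y by (simp add: m_assoc)
    also have "y \<otimes> z = z \<otimes> y" using z_comm y by simp
    finally show ?thesis using y z_cancel by (simp add: m_assoc)
  qed
  have c_inv: "c x = inv x \<or> c x = z \<otimes> inv x" if x: "x \<in> M" for x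
  proof -
    have "c (x \<otimes> c x) = x \<otimes> c x" using x abel[of "c x" x] by (simp add: c_mult c_c)
    then have "c x \<otimes> x \<in> {\<one>, z}" using fixed[of "x \<otimes> c x"] x abel[of "c x" x] by simp
    moreover have "c x = (c x \<otimes> x) \<otimes> inv x" using x by (simp add: m_assoc)
    ultimately show ?thesis using x by auto
  qed
  have tt_mem: "t \<otimes> t \<in> {\<one>, z}" using tt by (intro fixed) (auto simp: c_def m_assoc)
  show ?thesis
  proof (cases "\<forall>x\<in>M. x \<otimes> x = \<one> \<longrightarrow> x = \<one> \<or> x = z")
    case True
    obtain r where r: "r \<in> M" "ord r = 2 ^ (n - 1)" and pow: "\<And>x. x \<in> M \<Longrightarrow> \<exists>i::nat. x = r [^] i"
      using abelian_two_group_one_involution_cyclic[OF fin M.subgroup_axioms cardM abel, of z] True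
      by blast
    have rc [simp]: "r \<in> carrier G" using r by simp
    \<comment> \<open>Otherwise \<open>c\<close> fixes all of \<open>M\<close>, and \<open>t\<close> is central.\<close>
    have "c r \<noteq> r"
    proof
      assume cr: "c r = r"
      have c_pow: "c (r [^] i) = r [^] i" for i :: nat
        by (induction i) (simp_all add: c_mult cr, simp add: c_def)
      have "M \<subseteq> {\<one>, z}"
      proof
        fix x assume x: "x \<in> M"
        then obtain i :: nat where "x = r [^] i" using pow by blast
        then have "c x = x" using c_pow by simp
        then show "x \<in> {\<one>, z}" using fixed x by blast
      qed
      moreover have "t \<in> {x \<in> carrier G. \<forall>g\<in>carrier G. x \<otimes> g = g \<otimes> x}"
      proof -
        have "t \<otimes> g = g \<otimes> t" if g: "g \<in> carrier G" for g
        proof -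
          have tm: "t \<otimes> m = m \<otimes> t" if "m \<in> M" for m
            using that \<open>M \<subseteq> {\<one>, z}\<close> z_comm[of t] by auto
          show ?thesis
          proof (cases "g \<in> M")
            case False
            define m where "m = g \<otimes> inv t"
            have m: "m \<in> M" using cover[OF g] False by (simp add: m_def)
            have gm: "g = m \<otimes> t" using g by (simp add: m_def m_assoc)
            show ?thesis using tm[OF m] m by (simp add: gm m_assoc[symmetric])
          qed (use tm in blast)
        qed
        then show ?thesis by simp
      qed
      then have "t \<in> {\<one>, z}" using center by simp
      then show False using t_notin z by auto
    qed
    then have r_ne: "r \<noteq> \<one>" "r \<noteq> z" using c_z by (auto simp: c_def)
    have "r \<otimes> r \<noteq> \<one>" using True r r_ne by blast
    then have "\<not> ord r dvd 2" using pow_eq_id[OF rc, of 2] by (simp add: numeral_2_eq_2)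
    then have "\<not> n - 1 \<le> 1" using r(2) le_imp_power_dvd[of "n - 1" 1 "2::nat"] by auto
    then have n3: "n \<ge> 3" by simp
    define w where "w = r [^] (2 ^ (n - 2) :: nat)"
    have exps: "2 ^ (n - 1) = 2 * (2 ^ (n - 2) :: nat)"
      using n3 by (cases n; cases "n - 1") auto
    have "w \<otimes> w = r [^] (2 ^ (n - 1) :: nat)"
      unfolding w_def exps by (simp only: nat_pow_mult[OF rc] mult_2)
    then have "w \<otimes> w = \<one>" using r(2) pow_ord_eq_1[OF rc] by simp
    moreover have "w \<in> M"
    proof -
      have "r [^] k \<in> M" for k :: nat using r(1) by (induction k) auto
      then show ?thesis by (simp add: w_def)
    qed
    moreover have "w \<noteq> \<one>"
    proof
      assume "w = \<one>"
      then have "ord r dvd 2 ^ (n - 2)" using pow_eq_id[OF rc] by (simp add: w_def)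
      then show False using r(2) exps by (auto dest: dvd_imp_le)
    qed
    ultimately have w: "z = r [^] (2 ^ (n - 2) :: nat)" using True by (auto simp: w_def)
    have "t \<otimes> r \<otimes> inv t = inv r \<or> n \<ge> 4 \<and> t \<otimes> r \<otimes> inv t = z \<otimes> inv r"
    proof (cases "c r = inv r")
      case False
      then have cr: "c r = z \<otimes> inv r" using c_inv r by blast
      \<comment> \<open>For \<open>n = 3\<close> the exponent \<open>2 ^ (n - 2) - 1\<close> is \<open>1\<close>, so \<open>r\<close> would be fixed.\<close>
      have "n \<noteq> 3"
      proof
        assume "n = 3"
        then have "z = r \<otimes> r" using w by (simp add: numeral_2_eq_2)
        then have "c r = r" using cr by (simp add: m_assoc)
        then show False using \<open>c r \<noteq> r\<close> by simp
      qed
      then show ?thesis using cr n3 by (simp add: c_def)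
    qed (simp add: c_def)
    then show ?thesis
      using dihedral_type_if_cyclic[OF ordG n3 r pow w tt_mem] by blast
  next
    case False
    then obtain x where x: "x \<in> M" "x \<otimes> x = \<one>" "x \<noteq> \<one>" "x \<noteq> z" by blast
    have xc [simp]: "x \<in> carrier G" using x by simp
    have self_inv: "inv y = y" if "y \<otimes> y = \<one>" "y \<in> carrier G" for y
      using that inv_equality by blast
    have c_or: "c y = y \<or> c y = z \<otimes> y" if "y \<in> M" "y \<otimes> y = \<one>" for y
      using c_inv[OF that(1)] self_inv[OF that(2)] that by auto
    have cx: "c x = z \<otimes> x" using c_or[of x] fixed[of x] x by blast
    have fix_prod: "y \<in> {x, z \<otimes> x}" if y: "y \<in> M" "c y = z \<otimes> y" for y
    proof -
      have "c (x \<otimes> y) = z \<otimes> x \<otimes> (z \<otimes> y)" using x y cx by (simp add: c_mult)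
      also have "\<dots> = x \<otimes> y" using x y z_comm[of x] by (simp add: m_assoc z_cancel)
      finally have "x \<otimes> y \<in> {\<one>, z}" using x y by (intro fixed) auto
      moreover have "y = x \<otimes> (x \<otimes> y)" using x y by (simp add: m_assoc[symmetric])
      ultimately show ?thesis using z_comm[of x] by auto
    qed
    \<comment> \<open>A square root of \<open>z\<close> would be fixed or multiplied by \<open>z\<close> under \<open>c\<close>, but all such elements have trivial square.\<close>
    have z_nonsquare: "w \<otimes> w \<noteq> z" if w: "w \<in> M" for w
    proof
      assume ww: "w \<otimes> w = z"
      have "(z \<otimes> w) \<otimes> w = \<one>" using w ww zz by (simp add: m_assoc)
      then have "inv w = z \<otimes> w" using w by (intro inv_equality) auto
      then have "c w = z \<otimes> w \<or> c w = w" using c_inv[OF w] w z_cancel by auto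
      then have "w \<in> {\<one>, z, x, z \<otimes> x}" using fixed[OF w] fix_prod[OF w] by blast
      then have "w \<otimes> w = \<one>"
        using x zz z_square[of x] by auto
      then show False using ww z by simp
    qed
    have elementary: "y \<otimes> y = \<one>" if y: "y \<in> M" for y
    proof (rule ccontr)
      assume "y \<otimes> y \<noteq> \<one>"
      have yM: "y [^] k \<in> M" for k :: nat using y by (induction k) auto
      have "y [^] (2 ^ Suc 0 :: nat) \<noteq> \<one>" using \<open>y \<otimes> y \<noteq> \<one>\<close> y by (simp add: numeral_2_eq_2)
      moreover have "\<not> (\<forall>j. y [^] (2 ^ Suc j :: nat) \<noteq> \<one>)"
      proof -
        have "y [^] (2 ^ n :: nat) = \<one>" using pow_order_eq_1[of y] ordG y by simp
        moreover have "n = Suc (n - 1)" using n1 by simp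
        ultimately show ?thesis by metis
      qed
      ultimately obtain j where j: "y [^] (2 ^ Suc j :: nat) \<noteq> \<one>" "y [^] (2 ^ Suc (Suc j) :: nat) = \<one>"
        using nat_induct[of "\<lambda>j. y [^] (2 ^ Suc j :: nat) \<noteq> \<one>"] by blast
      define v where "v = y [^] (2 ^ j :: nat)"
      have v: "v \<in> M" using yM by (simp add: v_def)
      have vv: "v \<otimes> v = y [^] (2 ^ Suc j :: nat)"
        unfolding v_def by (simp only: nat_pow_mult[OF Mc[OF y]] power_Suc mult_2)
      have vvvv: "(v \<otimes> v) \<otimes> (v \<otimes> v) = \<one>"
        unfolding vv j(2)[symmetric] by (simp only: nat_pow_mult[OF Mc[OF y]] power_Suc mult_2)
      have vc: "v \<in> carrier G" using v by simp
      have "c (v \<otimes> v) = inv v \<otimes> inv v"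
        using c_inv[OF v] vc z_square[of "inv v"] by (auto simp: c_mult)
      also have "\<dots> = inv (v \<otimes> v)" using vc by (simp add: inv_mult_group)
      also have "\<dots> = v \<otimes> v" using vvvv vc by (intro self_inv) auto
      finally have "v \<otimes> v \<in> {\<one>, z}" using v by (intro fixed) auto
      then show False using z_nonsquare[OF v] vv j(1) by auto
    qed
    have M4: "M \<subseteq> {\<one>, z, x, z \<otimes> x}"
      using c_or elementary fixed fix_prod by blast
    have "x \<noteq> z \<otimes> x" "z \<otimes> x \<noteq> \<one>" "z \<otimes> x \<noteq> z"
    proof -
      show "x \<noteq> z \<otimes> x" using z(2) by simp
      show "z \<otimes> x \<noteq> z" using x(3) by simp
      show "z \<otimes> x \<noteq> \<one>"
      proof
        assume "z \<otimes> x = \<one>"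
        then have "z \<otimes> (z \<otimes> x) = z" by simp
        then show False using x(4) z_cancel[of x] by simp
      qed
    qed
    then have "card {\<one>, z, x, z \<otimes> x} = 4" using x z by (auto simp: card_insert_if)
    moreover have "{\<one>, z, x, z \<otimes> x} \<subseteq> M" using x z by simp
    then have "M = {\<one>, z, x, z \<otimes> x}" using M4 by (rule subset_antisym[rotated])
    ultimately have "card M = 4" by (simp only:)
    then have "2 ^ (n - 1) = (2::nat) ^ 2" using cardM by simp
    then have "n - 1 = 2" using power_inject_exp[of "2::nat" "n - 1" 2] by simp
    then have "n = 3" by simp
    moreover have "t \<otimes> x = z \<otimes> x \<otimes> t" using c_t[of x] cx by simp
    ultimately have "dihedral_2_group G"
      using dihedral_if_klein_four[OF _ x(1,2) z(1) zz M4 z_comm[OF t_closed, symmetric]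
          z_comm[OF xc, symmetric] tt_mem] ordG by simp
    then show ?thesis ..
  qed
qed

end

section \<open>Elements conjugate to their product with the central involution\<close>

lemma (in group) center_of_normal_is_normal:
  assumes "L \<lhd> G"
  shows "{x \<in> L. \<forall>y\<in>L. x \<otimes> y = y \<otimes> x} \<lhd> G"
proof -
  interpret L: normal L G by fact
  have Lc [simp]: "x \<in> carrier G" if "x \<in> L" for x using that by simp
  show ?thesis
  proof (rule normal_invI)
    show "subgroup {x \<in> L. \<forall>y\<in>L. x \<otimes> y = y \<otimes> x} G"
    proof (rule subgroupI)
      have "\<one> \<in> {x \<in> L. \<forall>y\<in>L. x \<otimes> y = y \<otimes> x}" by simp
      then show "{x \<in> L. \<forall>y\<in>L. x \<otimes> y = y \<otimes> x} \<noteq> {}" by blast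
      fix a assume "a \<in> {x \<in> L. \<forall>y\<in>L. x \<otimes> y = y \<otimes> x}"
      then have a: "a \<in> L" and a_comm: "\<And>y. y \<in> L \<Longrightarrow> a \<otimes> y = y \<otimes> a" by auto
      have "inv a \<otimes> y = y \<otimes> inv a" if y: "y \<in> L" for y
      proof -
        have "inv a \<otimes> y = inv a \<otimes> (y \<otimes> a) \<otimes> inv a" using a y by (simp add: m_assoc)
        also have "y \<otimes> a = a \<otimes> y" using a_comm y by simp
        finally show ?thesis using a y by (simp add: m_assoc[symmetric])
      qed
      then show "inv a \<in> {x \<in> L. \<forall>y\<in>L. x \<otimes> y = y \<otimes> x}" using a by simp
      fix b assume "b \<in> {x \<in> L. \<forall>y\<in>L. x \<otimes> y = y \<otimes> x}"
      then have b: "b \<in> L" and b_comm: "\<And>y. y \<in> L \<Longrightarrow> b \<otimes> y = y \<otimes> b" by auto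
      have "a \<otimes> b \<otimes> y = y \<otimes> (a \<otimes> b)" if y: "y \<in> L" for y
      proof -
        have "a \<otimes> b \<otimes> y = a \<otimes> (b \<otimes> y)" using a b y by (simp add: m_assoc)
        also have "b \<otimes> y = y \<otimes> b" using b_comm y by simp
        also have "a \<otimes> (y \<otimes> b) = a \<otimes> y \<otimes> b" using a b y by (simp add: m_assoc)
        also have "a \<otimes> y = y \<otimes> a" using a_comm y by simp
        finally show ?thesis using a b y by (simp add: m_assoc)
      qed
      then show "a \<otimes> b \<in> {x \<in> L. \<forall>y\<in>L. x \<otimes> y = y \<otimes> x}" using a b by simp
    qed auto
  next
    fix g h assume g: "g \<in> carrier G" and "h \<in> {x \<in> L. \<forall>y\<in>L. x \<otimes> y = y \<otimes> x}"
    then have h: "h \<in> L" and h_comm: "\<And>y. y \<in> L \<Longrightarrow> h \<otimes> y = y \<otimes> h" by auto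
    have "g \<otimes> h \<otimes> inv g \<otimes> y = y \<otimes> (g \<otimes> h \<otimes> inv g)" if y: "y \<in> L" for y
    proof -
      define y' where "y' = inv g \<otimes> y \<otimes> g"
      have y': "y' \<in> L" using L.inv_op_closed1[OF g y] by (simp add: y'_def)
      have "g \<otimes> h \<otimes> inv g \<otimes> y = g \<otimes> (h \<otimes> y') \<otimes> inv g"
        using g h y by (simp add: y'_def m_assoc)
      also have "h \<otimes> y' = y' \<otimes> h" using h_comm y' by simp
      also have "g \<otimes> (y' \<otimes> h) \<otimes> inv g = y \<otimes> (g \<otimes> h \<otimes> inv g)"
        using g h y by (simp add: y'_def m_assoc[symmetric])
      finally show ?thesis .
    qed
    then show "g \<otimes> h \<otimes> inv g \<in> {x \<in> L. \<forall>y\<in>L. x \<otimes> y = y \<otimes> x}"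
      using L.inv_op_closed2[OF g] h by simp
  qed
qed

lemma (in group) cancel_inv:
  assumes "x \<in> carrier G" "y \<in> carrier G"
  shows "x \<otimes> (inv x \<otimes> y) = y" and "inv x \<otimes> (x \<otimes> y) = y"
  using assms by (simp_all add: m_assoc[symmetric])

text \<open>
  Conjugation by \<open>g\<close> multiplies \<open>b\<close> by \<open>u\<close> and fixes \<open>b \<otimes> b\<close>; the factor that it puts on
  \<open>b \<otimes> b\<close> is \<open>u \<otimes> u\<close>.
\<close>

lemma (in group) twist_square_one:
  assumes c: "g \<in> carrier G" "b \<in> carrier G" "u \<in> carrier G"
    and gb: "g \<otimes> b = u \<otimes> b \<otimes> g" and ub: "b \<otimes> u = u \<otimes> b"
    and gbb: "g \<otimes> (b \<otimes> b) = (b \<otimes> b) \<otimes> g"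
  shows "u \<otimes> u = \<one>"
proof -
  have "(b \<otimes> b) \<otimes> g = (g \<otimes> b) \<otimes> b" using gbb c by (simp add: m_assoc)
  also have "\<dots> = (u \<otimes> b \<otimes> g) \<otimes> b" by (simp only: gb)
  also have "\<dots> = u \<otimes> b \<otimes> (g \<otimes> b)" using c by (simp add: m_assoc)
  also have "\<dots> = u \<otimes> b \<otimes> (u \<otimes> b \<otimes> g)" by (simp only: gb)
  also have "\<dots> = u \<otimes> (b \<otimes> u) \<otimes> b \<otimes> g" using c by (simp add: m_assoc)
  also have "\<dots> = u \<otimes> (u \<otimes> b) \<otimes> b \<otimes> g" by (simp only: ub)
  also have "\<dots> = (u \<otimes> u) \<otimes> ((b \<otimes> b) \<otimes> g)" using c by (simp add: m_assoc)
  finally show ?thesis using c by (metis m_closed r_cancel_one')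
qed

text \<open>
  The situation of a finite \<open>2\<close>-group with a faithful irreducible representation of degree above
  one: the central elements act as scalars, so \<open>-1\<close> is the only possible central involution \<open>z\<close>.
\<close>

locale two_group_one_central_involution = group G for G (structure) +
  fixes n :: nat and z
  assumes order_two_power: "Coset.order G = 2 ^ n"
    and z_closed [simp]: "z \<in> carrier G" and z_ne_one: "z \<noteq> \<one>" and z_square: "z \<otimes> z = \<one>"
    and z_central: "g \<in> carrier G \<Longrightarrow> z \<otimes> g = g \<otimes> z"
    and z_unique: "x \<in> carrier G \<Longrightarrow> x \<otimes> x = \<one> \<Longrightarrow>
        (\<And>g. g \<in> carrier G \<Longrightarrow> x \<otimes> g = g \<otimes> x) \<Longrightarrow> x = \<one> \<or> x = z"
    and non_abelian: "\<exists>x\<in>carrier G. \<exists>y\<in>carrier G. x \<otimes> y \<noteq> y \<otimes> x"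
begin

text \<open>
  The elements that are conjugate to their product with \<open>z\<close>. When \<open>z\<close> acts as \<open>-1\<close>, the trace of
  such an element equals its own negative.
\<close>

definition twisted :: "'a set" where
  "twisted = {g \<in> carrier G. \<exists>h\<in>carrier G. h \<otimes> g = z \<otimes> g \<otimes> h}"

lemma z_cancel: "y \<in> carrier G \<Longrightarrow> z \<otimes> (z \<otimes> y) = y"
  using z_square by (simp add: m_assoc[symmetric])

lemma z_neq: "y \<in> carrier G \<Longrightarrow> z \<otimes> y \<noteq> y"
  using z_ne_one by simp

lemma finite_carrier: "finite (carrier G)"
  using finite_carrier_of_order_two_power order_two_power by blast

text \<open>
  Let \<open>a\<close> represent an involution that is central modulo the center. Conjugation changes \<open>a\<close> by
  central factors whose square is trivial, that is, by \<open>\<one>\<close> or \<open>z\<close>. Hence \<open>a\<close> has only two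
  conjugates, and its centralizer has index two.
\<close>

lemma index_two_centralizer:
  obtains a t where "a \<in> carrier G"
    and "index_two_subgroup G {g \<in> carrier G. g \<otimes> a = a \<otimes> g} t"
    and "\<And>g. g \<in> carrier G \<Longrightarrow> g \<otimes> a = a \<otimes> g \<or> g \<otimes> a = z \<otimes> a \<otimes> g"
proof -
  define Z where "Z = {x \<in> carrier G. \<forall>y\<in>carrier G. x \<otimes> y = y \<otimes> x}"
  have carrier_normal: "carrier G \<lhd> G" by (intro normal_invI subgroup_self) auto
  have Z_normal: "Z \<lhd> G" unfolding Z_def by (rule center_of_normal_is_normal[OF carrier_normal])
  have Z_less: "Z \<subset> carrier G" using non_abelian by (auto simp: Z_def)
  obtain a where a: "a \<in> carrier G - Z" "a \<otimes> a \<in> Z"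
    and a_comm: "\<forall>g\<in>carrier G. \<exists>u\<in>Z. g \<otimes> a = u \<otimes> a \<otimes> g"
    using two_group_central_mod_normal[OF order_two_power Z_normal carrier_normal Z_less]
    by (elim bexE conjE)
  have ac [simp]: "a \<in> carrier G" using a by simp
  have alt: "g \<otimes> a = a \<otimes> g \<or> g \<otimes> a = z \<otimes> a \<otimes> g" if g: "g \<in> carrier G" for g
  proof -
    obtain u where u: "u \<in> Z" "g \<otimes> a = u \<otimes> a \<otimes> g" using a_comm g by blast
    have "u \<in> carrier G" "a \<otimes> u = u \<otimes> a" using u(1) by (auto simp: Z_def)
    moreover have "g \<otimes> (a \<otimes> a) = (a \<otimes> a) \<otimes> g" using a(2) g by (simp add: Z_def)
    ultimately have "u \<otimes> u = \<one>" using twist_square_one[OF g ac _ u(2)] by blast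
    moreover have "u \<in> carrier G" and u_comm: "\<And>h. h \<in> carrier G \<Longrightarrow> u \<otimes> h = h \<otimes> u"
      using u(1) by (auto simp: Z_def)
    ultimately have "u = \<one> \<or> u = z" using z_unique[OF _ _ u_comm] by blast
    then show ?thesis using u by auto
  qed
  define M where "M = {g \<in> carrier G. g \<otimes> a = a \<otimes> g}"
  obtain t where t: "t \<in> carrier G" "t \<notin> M" using a(1) by (auto simp: Z_def M_def)
  have M: "subgroup M G"
  proof (rule subgroupI)
    fix x assume "x \<in> M"
    then have x: "x \<in> carrier G" "x \<otimes> a = a \<otimes> x" by (auto simp: M_def)
    have "inv x \<otimes> a = inv x \<otimes> (a \<otimes> x) \<otimes> inv x" using x(1) by (simp add: m_assoc)
    also have "inv x \<otimes> (a \<otimes> x) \<otimes> inv x = inv x \<otimes> (x \<otimes> a) \<otimes> inv x" by (simp only: x(2))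
    also have "\<dots> = a \<otimes> inv x" using x(1) by (simp add: m_assoc[symmetric])
    finally show "inv x \<in> M" using x(1) by (simp add: M_def)
    fix y assume "y \<in> M"
    then have y: "y \<in> carrier G" "y \<otimes> a = a \<otimes> y" by (auto simp: M_def)
    have "x \<otimes> y \<otimes> a = x \<otimes> (y \<otimes> a)" using x(1) y(1) by (simp add: m_assoc)
    also have "\<dots> = x \<otimes> (a \<otimes> y)" by (simp only: y(2))
    also have "\<dots> = (x \<otimes> a) \<otimes> y" using x(1) y(1) by (simp add: m_assoc)
    also have "\<dots> = (a \<otimes> x) \<otimes> y" by (simp only: x(2))
    finally show "x \<otimes> y \<in> M" using x(1) y(1) by (simp add: M_def m_assoc)
  qed (auto simp: M_def intro!: exI[of _ \<one>])
  have t_inv: "inv t \<notin> M" using t M subgroup.m_inv_closed[OF M, of "inv t"] by auto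
  have "g \<in> M \<or> g \<otimes> inv t \<in> M" if g: "g \<in> carrier G" for g
  proof (cases "g \<in> M")
    case False
    then have ga: "g \<otimes> a = z \<otimes> a \<otimes> g" using alt g by (auto simp: M_def)
    have ta: "inv t \<otimes> a = z \<otimes> a \<otimes> inv t" using alt[of "inv t"] t t_inv by (auto simp: M_def)
    have "g \<otimes> inv t \<otimes> a = g \<otimes> (z \<otimes> a \<otimes> inv t)" using g t ta by (simp add: m_assoc)
    also have "\<dots> = (g \<otimes> z) \<otimes> a \<otimes> inv t" using g t by (simp add: m_assoc)
    also have "g \<otimes> z = z \<otimes> g" using z_central g by simp
    also have "z \<otimes> g \<otimes> a \<otimes> inv t = z \<otimes> (g \<otimes> a) \<otimes> inv t" using g t by (simp add: m_assoc)
    also have "\<dots> = a \<otimes> (g \<otimes> inv t)" unfolding ga using g t z_cancel by (simp add: m_assoc)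
    finally show ?thesis using g t by (simp add: M_def)
  qed simp
  then have "index_two_subgroup G M t"
    using M t is_group by unfold_locales (auto simp: subgroup_def)
  then show thesis using that alt ac unfolding M_def by blast
qed

text \<open>
  Inside \<open>M\<close> the coset of \<open>a\<close> modulo the center consists of twisted elements, and \<open>z\<close> shows that
  the center has at least two elements. If there are only two twisted elements in \<open>M\<close>, the
  center has order two, which is the situation classified above.
\<close>

lemma abelian_index_two_case:
  assumes M: "index_two_subgroup G M t"
    and outside: "carrier G - M \<subseteq> twisted"
    and a: "a \<in> M" "t \<otimes> a = z \<otimes> a \<otimes> t"
    and abel: "\<And>x y. x \<in> M \<Longrightarrow> y \<in> M \<Longrightarrow> x \<otimes> y = y \<otimes> x"
  shows "card twisted \<ge> 2 ^ (n - 1) + 2"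
    and "card twisted = 2 ^ (n - 1) + 2 \<Longrightarrow>
      dihedral_2_group G \<or> semidihedral_2_group G \<or> generalized_quaternion_group G"
proof -
  interpret index_two_subgroup G M t by fact
  define Z where "Z = {x \<in> carrier G. \<forall>g\<in>carrier G. x \<otimes> g = g \<otimes> x}"
  have ac [simp]: "a \<in> carrier G" using a by simp
  have ZM: "u \<in> M" if u: "u \<in> Z" for u
  proof (rule ccontr)
    assume "u \<notin> M"
    then have "inv u \<notin> M" using u by (simp add: Z_def inv_mem_iff)
    then have "inv u \<otimes> t \<in> M" using u t_notin by (simp add: Z_def mult_mem_iff)
    then have "(inv u \<otimes> t) \<otimes> a = a \<otimes> (inv u \<otimes> t)" using abel a by blast
    moreover have uc: "u \<in> carrier G" using u by (simp add: Z_def)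
    ultimately have "u \<otimes> (a \<otimes> (inv u \<otimes> t)) = u \<otimes> ((inv u \<otimes> t) \<otimes> a)" by simp
    also have "\<dots> = t \<otimes> a" using uc by (simp add: m_assoc cancel_inv)
    finally have "t \<otimes> a = u \<otimes> (a \<otimes> (inv u \<otimes> t))" ..
    also have "\<dots> = (u \<otimes> a) \<otimes> (inv u \<otimes> t)" using uc by (simp add: m_assoc)
    also have "u \<otimes> a = a \<otimes> u" using u by (simp add: Z_def)
    also have "(a \<otimes> u) \<otimes> (inv u \<otimes> t) = a \<otimes> t" using uc by (simp add: m_assoc cancel_inv)
    finally have "z \<otimes> (a \<otimes> t) = a \<otimes> t" using a by (simp add: m_assoc)
    then show False using z_neq[of "a \<otimes> t"] by simp
  qed
  have zZ: "z \<in> Z" using z_central by (simp add: Z_def)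
  have coset: "(\<lambda>u. a \<otimes> u) ` Z \<subseteq> twisted \<inter> M"
  proof
    fix y assume "y \<in> (\<lambda>u. a \<otimes> u) ` Z"
    then obtain u where u: "u \<in> Z" "y = a \<otimes> u" by blast
    have uc: "u \<in> carrier G" and ut: "u \<otimes> t = t \<otimes> u" using u by (auto simp: Z_def)
    have "t \<otimes> y = (t \<otimes> a) \<otimes> u" using uc by (simp add: u m_assoc)
    also have "\<dots> = z \<otimes> a \<otimes> (t \<otimes> u)" using uc a by (simp add: m_assoc)
    also have "\<dots> = z \<otimes> y \<otimes> t" using uc by (simp add: u ut[symmetric] m_assoc)
    finally show "y \<in> twisted \<inter> M" using uc u a ZM by (auto simp: twisted_def)
  qed
  have fin: "finite (twisted \<inter> M)" "finite (carrier G - M)"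
    using finite_carrier by (auto simp: twisted_def)
  have "twisted = (carrier G - M) \<union> (twisted \<inter> M)" using outside by (auto simp: twisted_def)
  then have "card twisted = card ((carrier G - M) \<union> (twisted \<inter> M))" by simp
  also have "\<dots> = card (carrier G - M) + card (twisted \<inter> M)"
    using fin by (intro card_Un_disjoint) auto
  finally have split: "card twisted = 2 ^ (n - 1) + card (twisted \<inter> M)"
    using card_outside[OF order_two_power] by simp
  have "inj_on (\<lambda>u. a \<otimes> u) Z" by (auto simp: inj_on_def Z_def)
  then have le: "card Z \<le> card (twisted \<inter> M)"
    using coset fin by (metis card_image card_mono)
  have "{\<one>, z} \<subseteq> Z" using zZ by (auto simp: Z_def)
  moreover have finZ: "finite Z" using finite_carrier by (auto simp: Z_def)
  moreover have two: "card {\<one>, z} = 2" using z_ne_one by auto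
  ultimately have ge: "card Z \<ge> 2" by (metis card_mono)
  show "card twisted \<ge> 2 ^ (n - 1) + 2" using split le ge by simp
  assume "card twisted = 2 ^ (n - 1) + 2"
  then have "card Z = 2" using split le ge by simp
  then have "{\<one>, z} = Z" using \<open>{\<one>, z} \<subseteq> Z\<close> finZ two by (metis card_subset_eq)
  then show "dihedral_2_group G \<or> semidihedral_2_group G \<or> generalized_quaternion_group G"
    using dihedral_type_if_center_two[OF order_two_power abel ZM[OF zZ] z_ne_one]
    by (simp add: Z_def)
qed

text \<open>
  If \<open>M\<close> is not abelian, there are more than two twisted elements in \<open>M\<close>. Let \<open>b\<close> represent an
  involution of \<open>M\<close> modulo the center of \<open>M\<close> that is central in \<open>G\<close> modulo it. Some element
  of \<open>M\<close> multiplies \<open>b\<close> by an involution \<open>e\<close> of the center of \<open>M\<close>. Either \<open>e\<close> is fixed by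
  \<open>t\<close>, hence equal to \<open>z\<close>, or its product with its conjugate is fixed by \<open>t\<close> and equal to \<open>z\<close>.
  In both cases some \<open>m\<close> in \<open>M\<close> multiplies \<open>b\<close> by \<open>z\<close>; then \<open>b\<close> twists each of the four
  elements \<open>m \<otimes> k\<close> with \<open>k\<close> in \<open>{\<one>, z, b, z \<otimes> b}\<close>.
\<close>

lemma nonabelian_index_two_case:
  assumes M: "index_two_subgroup G M t"
    and outside: "carrier G - M \<subseteq> twisted"
    and zM: "z \<in> M"
    and nonabel: "\<exists>x\<in>M. \<exists>y\<in>M. x \<otimes> y \<noteq> y \<otimes> x"
  shows "card twisted \<ge> 2 ^ (n - 1) + 4"
proof -
  interpret index_two_subgroup G M t by fact
  define Z where "Z = {x \<in> M. \<forall>y\<in>M. x \<otimes> y = y \<otimes> x}"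
  have Z_normal: "Z \<lhd> G" unfolding Z_def by (rule center_of_normal_is_normal[OF normal])
  interpret Z: normal Z G by fact
  have Zc: "u \<in> carrier G" if "u \<in> Z" for u using that by (rule Z.mem_carrier)
  have Z_comm: "u \<otimes> y = y \<otimes> u" if "u \<in> Z" "y \<in> M" for u y using that by (simp add: Z_def)
  have "Z \<subset> M" using nonabel by (auto simp: Z_def)
  then obtain b where b: "b \<in> M" "b \<notin> Z" "b \<otimes> b \<in> Z"
    and b_comm: "\<And>g. g \<in> carrier G \<Longrightarrow> \<exists>u\<in>Z. g \<otimes> b = u \<otimes> b \<otimes> g"
    using two_group_central_mod_normal[OF order_two_power Z_normal normal] by blast
  have bc [simp]: "b \<in> carrier G" using b by simp
  obtain m1 where m1: "m1 \<in> M" "m1 \<otimes> b \<noteq> b \<otimes> m1" using b by (auto simp: Z_def)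
  have m1c [simp]: "m1 \<in> carrier G" using m1 by simp
  obtain e where e: "e \<in> Z" "m1 \<otimes> b = e \<otimes> b \<otimes> m1" using b_comm[of m1] by auto
  have ec [simp]: "e \<in> carrier G" using e Zc by simp
  have e_ne: "e \<noteq> \<one>" using e m1 by auto
  have ee: "e \<otimes> e = \<one>"
    using twist_square_one[OF m1c bc ec e(2)] Z_comm[OF e(1) b(1)] Z_comm[OF b(3) m1(1)] by simp
  define e' where "e' = t \<otimes> e \<otimes> inv t"
  have e': "e' \<in> Z" using Z.inv_op_closed2 e by (simp add: e'_def)
  have e'c [simp]: "e' \<in> carrier G" using e' Zc by simp
  have te: "t \<otimes> e = e' \<otimes> t" by (simp add: e'_def m_assoc)
  have central_if: "u \<otimes> g = g \<otimes> u" if u: "u \<in> Z" "t \<otimes> u = u \<otimes> t" and g: "g \<in> carrier G" for u g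
  proof (cases "g \<in> M")
    case False
    define m where "m = g \<otimes> inv t"
    have m: "m \<in> M" using cover[OF g] False by (simp add: m_def)
    have gm: "g = m \<otimes> t" using g by (simp add: m_def m_assoc)
    have "u \<otimes> g = (u \<otimes> m) \<otimes> t" using m u Zc by (simp add: gm m_assoc)
    also have "u \<otimes> m = m \<otimes> u" by (rule Z_comm[OF u(1) m])
    finally show ?thesis using m u Zc by (simp add: gm m_assoc)
  qed (use Z_comm u in blast)
  have "\<exists>m\<in>M. m \<otimes> b = z \<otimes> b \<otimes> m"
  proof (cases "e' = e")
    case True
    then have "t \<otimes> e = e \<otimes> t" using te by simp
    then have "e = z" using z_unique[OF ec ee central_if[OF e(1)]] e_ne by blast
    then show ?thesis using m1 e by blast
  next
    case False
    have tt: "t \<otimes> t \<in> M" using t_notin by (simp add: mult_mem_iff)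
    have te': "t \<otimes> e' = e \<otimes> t"
    proof -
      have "t \<otimes> e' = (t \<otimes> t) \<otimes> e \<otimes> inv t" by (simp add: e'_def m_assoc)
      also have "(t \<otimes> t) \<otimes> e = e \<otimes> (t \<otimes> t)" using Z_comm[OF e(1) tt] by simp
      finally show ?thesis by (simp add: m_assoc)
    qed
    have eM: "e \<in> M" "e' \<in> M" using e e' by (auto simp: Z_def)
    have comm: "e \<otimes> e' = e' \<otimes> e" by (rule Z_comm[OF e(1) eM(2)])
    have "t \<otimes> (e \<otimes> e') = e' \<otimes> (t \<otimes> e')" using te by (simp add: m_assoc[symmetric])
    also have "\<dots> = (e \<otimes> e') \<otimes> t" using te' comm by (simp add: m_assoc[symmetric])
    finally have t_fix: "t \<otimes> (e \<otimes> e') = (e \<otimes> e') \<otimes> t" .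
    have e'e': "e' \<otimes> e' = \<one>"
    proof -
      have "e' \<otimes> e' = t \<otimes> (e \<otimes> e) \<otimes> inv t"
        by (simp add: e'_def m_assoc) (simp add: m_assoc[symmetric])
      then show ?thesis using ee by simp
    qed
    have "(e \<otimes> e') \<otimes> (e \<otimes> e') = e \<otimes> (e' \<otimes> e) \<otimes> e'" by (simp add: m_assoc)
    also have "\<dots> = (e \<otimes> e) \<otimes> (e' \<otimes> e')" unfolding comm[symmetric] by (simp add: m_assoc)
    finally have sq: "(e \<otimes> e') \<otimes> (e \<otimes> e') = \<one>" using ee e'e' by simp
    have "e \<otimes> e' \<noteq> \<one>"
    proof
      assume "e \<otimes> e' = \<one>"
      then have "e \<otimes> (e \<otimes> e') = e" by simp
      then have "e' = e" using ee by (simp add: m_assoc[symmetric])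
      then show False using False by simp
    qed
    moreover have "e \<otimes> e' \<in> Z" using e e' by blast
    ultimately have ez: "e \<otimes> e' = z" using z_unique[OF _ sq] central_if[OF _ t_fix] by auto
    \<comment> \<open>The conjugate of \<open>m1\<close> multiplies \<open>b\<close> by \<open>e'\<close>, because \<open>t\<close> changes \<open>b\<close> only by an element \<open>v\<close> of \<open>Z\<close>.\<close>
    define m2 where "m2 = t \<otimes> m1 \<otimes> inv t"
    have m2: "m2 \<in> M" using normal.inv_op_closed2[OF normal t_closed m1(1)] by (simp add: m2_def)
    have m2c [simp]: "m2 \<in> carrier G" using m2 by simp
    obtain v where v: "v \<in> Z" "t \<otimes> b = v \<otimes> b \<otimes> t" using b_comm[of t] by auto
    have vc [simp]: "v \<in> carrier G" using v Zc by simp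
    have m2t: "m2 \<otimes> t = t \<otimes> m1" by (simp add: m2_def m_assoc)
    have "v \<otimes> (m2 \<otimes> b) \<otimes> t = (v \<otimes> m2) \<otimes> b \<otimes> t" by (simp add: m_assoc)
    also have "v \<otimes> m2 = m2 \<otimes> v" by (rule Z_comm[OF v(1) m2])
    also have "m2 \<otimes> v \<otimes> b \<otimes> t = m2 \<otimes> (t \<otimes> b)" using v by (simp add: m_assoc)
    also have "\<dots> = t \<otimes> (m1 \<otimes> b)" using m2t by (simp add: m_assoc[symmetric])
    also have "\<dots> = (t \<otimes> e) \<otimes> b \<otimes> m1" using e by (simp add: m_assoc)
    also have "\<dots> = e' \<otimes> (t \<otimes> b) \<otimes> m1" using te by (simp add: m_assoc)
    also have "\<dots> = (e' \<otimes> v) \<otimes> b \<otimes> (t \<otimes> m1)" using v by (simp add: m_assoc)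
    also have "e' \<otimes> v = v \<otimes> e'" using Z_comm[OF v(1) eM(2)] by simp
    also have "v \<otimes> e' \<otimes> b \<otimes> (t \<otimes> m1) = v \<otimes> (e' \<otimes> b \<otimes> m2) \<otimes> t"
      using m2t by (simp add: m_assoc)
    finally have m2b: "m2 \<otimes> b = e' \<otimes> b \<otimes> m2" by simp
    have "(m1 \<otimes> m2) \<otimes> b = (m1 \<otimes> e') \<otimes> b \<otimes> m2" using m2b by (simp add: m_assoc)
    also have "m1 \<otimes> e' = e' \<otimes> m1" using Z_comm[OF e' m1(1)] by simp
    also have "e' \<otimes> m1 \<otimes> b \<otimes> m2 = e' \<otimes> (m1 \<otimes> b) \<otimes> m2" by (simp add: m_assoc)
    also have "\<dots> = (e' \<otimes> e) \<otimes> b \<otimes> (m1 \<otimes> m2)" using e by (simp add: m_assoc)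
    also have "e' \<otimes> e = z" using comm ez by simp
    finally show ?thesis using m1 m2 by blast
  qed
  then obtain m where m: "m \<in> M" "m \<otimes> b = z \<otimes> b \<otimes> m" by blast
  have mc [simp]: "m \<in> carrier G" using m by simp
  have bm: "b \<otimes> m = z \<otimes> m \<otimes> b"
  proof -
    have "z \<otimes> m \<otimes> b = z \<otimes> (m \<otimes> b)" by (simp add: m_assoc)
    also have "\<dots> = b \<otimes> m" unfolding m(2) using z_cancel by (simp add: m_assoc)
    finally show ?thesis by simp
  qed
  define K where "K = {\<one>, z, b, z \<otimes> b}"
  have zZ: "z \<in> Z" using zM z_central by (simp add: Z_def)
  have K_card: "card K = 4"
  proof -
    have "b \<noteq> \<one>" "b \<noteq> z" using b zZ by auto
    moreover have "z \<otimes> b \<noteq> \<one>" "z \<otimes> b \<noteq> z"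
    proof -
      show "z \<otimes> b \<noteq> \<one>"
      proof
        assume "z \<otimes> b = \<one>"
        then have "z \<otimes> (z \<otimes> b) = z" by simp
        then show False using \<open>b \<noteq> z\<close> z_cancel by simp
      qed
      show "z \<otimes> b \<noteq> z" using \<open>b \<noteq> \<one>\<close> by simp
    qed
    moreover have "z \<otimes> b \<noteq> b" by (rule z_neq[OF bc])
    ultimately show ?thesis using z_ne_one by (auto simp: K_def card_insert_if)
  qed
  have K: "k \<in> M" "b \<otimes> k = k \<otimes> b" if "k \<in> K" for k
  proof -
    show "k \<in> M" using that b zM by (auto simp: K_def)
    have "b \<otimes> (z \<otimes> b) = (b \<otimes> z) \<otimes> b" by (simp add: m_assoc)
    then have "b \<otimes> (z \<otimes> b) = z \<otimes> b \<otimes> b" using z_central[of b] by simp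
    then show "b \<otimes> k = k \<otimes> b" using that z_central[of b] by (auto simp: K_def)
  qed
  have Kc: "k \<in> carrier G" if "k \<in> K" for k using K(1)[OF that] by simp
  have "(\<lambda>k. m \<otimes> k) ` K \<subseteq> twisted \<inter> M"
  proof
    fix y assume "y \<in> (\<lambda>k. m \<otimes> k) ` K"
    then obtain k where k: "k \<in> K" "y = m \<otimes> k" by blast
    have "b \<otimes> y = (b \<otimes> m) \<otimes> k" using Kc[OF k(1)] by (simp add: k m_assoc)
    also have "\<dots> = z \<otimes> m \<otimes> (b \<otimes> k)" using Kc[OF k(1)] bm by (simp add: m_assoc)
    also have "\<dots> = z \<otimes> y \<otimes> b" using Kc[OF k(1)] K(2)[OF k(1)] by (simp add: k m_assoc)
    finally show "y \<in> twisted \<inter> M"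
      using Kc[OF k(1)] K(1)[OF k(1)] k m by (auto simp: twisted_def)
  qed
  moreover have "inj_on (\<lambda>k. m \<otimes> k) K" using Kc by (auto simp: inj_on_def)
  moreover have fin: "finite (twisted \<inter> M)" "finite (carrier G - M)"
    using finite_carrier by (auto simp: twisted_def)
  ultimately have ge: "card (twisted \<inter> M) \<ge> 4" using K_card by (metis card_image card_mono)
  have "twisted = (carrier G - M) \<union> (twisted \<inter> M)" using outside by (auto simp: twisted_def)
  then have "card twisted = card ((carrier G - M) \<union> (twisted \<inter> M))" by simp
  also have "\<dots> = card (carrier G - M) + card (twisted \<inter> M)"
    using fin by (intro card_Un_disjoint) auto
  finally show ?thesis using card_outside[OF order_two_power] ge by simp
qed

theorem card_twisted:
  shows "card twisted \<ge> 2 ^ (n - 1) + 2"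
    and "card twisted = 2 ^ (n - 1) + 2 \<Longrightarrow>
      dihedral_2_group G \<or> semidihedral_2_group G \<or> generalized_quaternion_group G"
proof -
  obtain a t where ac [simp]: "a \<in> carrier G"
    and idx: "index_two_subgroup G {g \<in> carrier G. g \<otimes> a = a \<otimes> g} t"
    and alt: "\<And>g. g \<in> carrier G \<Longrightarrow> g \<otimes> a = a \<otimes> g \<or> g \<otimes> a = z \<otimes> a \<otimes> g"
    using index_two_centralizer by blast
  define M where "M = {g \<in> carrier G. g \<otimes> a = a \<otimes> g}"
  have idxM: "index_two_subgroup G M t" using idx by (simp add: M_def)
  have M_iff: "g \<in> M \<longleftrightarrow> g \<otimes> a = a \<otimes> g" if "g \<in> carrier G" for g
    using that by (simp add: M_def)
  interpret index_two_subgroup G M t by (rule idxM)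
  \<comment> \<open>An element that multiplies \<open>a\<close> by \<open>z\<close> is in turn multiplied by \<open>z\<close> under conjugation by \<open>a\<close>.\<close>
  have outside: "carrier G - M \<subseteq> twisted"
  proof
    fix g assume gM: "g \<in> carrier G - M"
    then have "g \<otimes> a \<noteq> a \<otimes> g" using M_iff[of g] by blast
    with gM have g: "g \<in> carrier G" "g \<otimes> a = z \<otimes> a \<otimes> g" using alt[of g] by blast+
    have "z \<otimes> g \<otimes> a = z \<otimes> (g \<otimes> a)" using g by (simp add: m_assoc)
    also have "\<dots> = a \<otimes> g" unfolding g(2) using g z_cancel by (simp add: m_assoc)
    finally show "g \<in> twisted" using g by (auto simp: twisted_def intro!: bexI[of _ a])
  qed
  have "t \<otimes> a \<noteq> a \<otimes> t" using t_notin M_iff[OF t_closed] by blast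
  then have ta: "t \<otimes> a = z \<otimes> a \<otimes> t" using alt[OF t_closed] by blast
  have aM: "a \<in> M" using M_iff[OF ac] by blast
  have zM: "z \<in> M" using M_iff[OF z_closed] z_central[OF ac] by blast
  have "card twisted \<ge> 2 ^ (n - 1) + 2 \<and> (card twisted = 2 ^ (n - 1) + 2 \<longrightarrow>
      dihedral_2_group G \<or> semidihedral_2_group G \<or> generalized_quaternion_group G)"
  proof (cases "\<exists>x\<in>M. \<exists>y\<in>M. x \<otimes> y \<noteq> y \<otimes> x")
    case True
    have "2 ^ (n - 1) + 4 \<le> card twisted"
      by (rule nonabelian_index_two_case[OF idxM outside zM True])
    then have "2 ^ (n - 1) + 2 < card twisted" by simp
    then show ?thesis by simp
  next
    case False
    then have abel: "x \<otimes> y = y \<otimes> x" if "x \<in> M" "y \<in> M" for x y using that by blast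
    show ?thesis using abelian_index_two_case[OF idxM outside aM ta abel] by blast
  qed
  then show "card twisted \<ge> 2 ^ (n - 1) + 2"
    and "card twisted = 2 ^ (n - 1) + 2 \<Longrightarrow>
      dihedral_2_group G \<or> semidihedral_2_group G \<or> generalized_quaternion_group G" by blast+
qed

end

section \<open>Irreducible representations and Schur's lemma\<close>

lemma GL_simps:
  "monoid.mult (GL d) = (*)" "one (GL d) = 1\<^sub>m d" "carrier (GL d) \<subseteq> carrier_mat d d"
  by (auto simp: GL_def units_of_mult units_of_one units_of_carrier ring_mat_simps Units_def)

lemma group_GL: "group (GL d)"
proof -
  interpret ring "ring_mat TYPE(complex) d ()" by (rule ring_mat)
  show ?thesis unfolding GL_def by (rule units_group)
qed

lemma mat_trace_comm:
  assumes "A \<in> carrier_mat d d" "B \<in> carrier_mat d d"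
  shows "mat_trace (A * B) = mat_trace (B * A)"
proof -
  have "mat_trace (A * B) = (\<Sum>i<d. \<Sum>j<d. A $$ (i, j) * B $$ (j, i))"
    using assms by (auto simp: mat_trace_def scalar_prod_def atLeast0LessThan intro!: sum.cong)
  also have "\<dots> = (\<Sum>j<d. \<Sum>i<d. A $$ (i, j) * B $$ (j, i))" by (rule sum.swap)
  also have "\<dots> = mat_trace (B * A)"
    using assms by (auto simp: mat_trace_def scalar_prod_def atLeast0LessThan mult.commute intro!: sum.cong)
  finally show ?thesis .
qed

lemma mat_trace_smult: "mat_trace (c \<cdot>\<^sub>m A) = c * mat_trace A" if "A \<in> carrier_mat d d"
  using that by (simp add: mat_trace_def sum_distrib_left)

lemma mat_trace_one: "mat_trace (1\<^sub>m d) = of_nat d"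
  by (simp add: mat_trace_def)

lemma mat_trace_zero_if_conjugate_to_negative:
  assumes A: "A \<in> carrier_mat d d" and B: "B \<in> carrier_mat d d" and B': "B' \<in> carrier_mat d d"
    and inv: "B * B' = 1\<^sub>m d" and BA: "B * A = (-1) \<cdot>\<^sub>m (A * B)"
  shows "mat_trace A = 0"
proof -
  have inv': "B' * B = 1\<^sub>m d" by (rule mat_mult_left_right_inverse[OF B B' inv])
  have AB: "A * B \<in> carrier_mat d d" using A B by simp
  have "A = (B' * B) * A" using A inv' by simp
  also have "\<dots> = B' * (B * A)" using A B B' by simp
  also have "\<dots> = (-1) \<cdot>\<^sub>m (B' * (A * B))"
    unfolding BA by (rule mult_smult_distrib[OF B' AB])
  finally have "mat_trace A = - mat_trace (B' * (A * B))"
    using AB B' by (metis mat_trace_smult mult_carrier_mat mult_minus1)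
  also have "mat_trace (B' * (A * B)) = mat_trace ((A * B) * B')" by (rule mat_trace_comm[OF B' AB])
  also have "(A * B) * B' = A" using A B B' inv by (simp add: assoc_mult_mat)
  finally show ?thesis by simp
qed

lemma subspace_module_vecI:
  fixes W :: "complex vec set"
  assumes "W \<subseteq> carrier_vec d" "0\<^sub>v d \<in> W"
    and "\<And>v w. v \<in> W \<Longrightarrow> w \<in> W \<Longrightarrow> v + w \<in> W"
    and "\<And>c v. v \<in> W \<Longrightarrow> c \<cdot>\<^sub>v v \<in> W"
  shows "VectorSpace.subspace class_ring W (module_vec TYPE(complex) d)"
  unfolding VectorSpace.subspace_def submodule_def
  using vec_vs vec_module assms by (auto simp: module_vec_simps)

lemma eq_smult_one_if_all_eigenvectors:
  fixes A :: "complex mat"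
  assumes A: "A \<in> carrier_mat d d" and eig: "\<And>v. v \<in> carrier_vec d \<Longrightarrow> A *\<^sub>v v = c \<cdot>\<^sub>v v"
  shows "A = c \<cdot>\<^sub>m 1\<^sub>m d"
proof (rule eq_matI)
  fix i j assume "i < dim_row (c \<cdot>\<^sub>m 1\<^sub>m d :: complex mat)" "j < dim_col (c \<cdot>\<^sub>m 1\<^sub>m d :: complex mat)"
  then have ij: "i < d" "j < d" by auto
  have "A $$ (i, j) = (A *\<^sub>v unit_vec d j) $ i"
    using A ij by (simp add: scalar_prod_right_unit)
  also have "\<dots> = (c \<cdot>\<^sub>v unit_vec d j) $ i" using eig by simp
  finally show "A $$ (i, j) = (c \<cdot>\<^sub>m 1\<^sub>m d) $$ (i, j)" using ij by (simp add: unit_vec_def)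
qed (use A in auto)

locale irreducible_rep = group G for G (structure) +
  fixes d :: nat and \<rho> :: "'a \<Rightarrow> complex mat"
  assumes irreducible: "irreducible_representation G d \<rho>"
begin

lemma rho_hom: "\<rho> \<in> hom G (GL d)" and d_pos: "d > 0"
  using irreducible by (auto simp: irreducible_representation_def representation_def)

lemma rho_group_hom: "group_hom G (GL d) \<rho>"
  using rho_hom is_group group_GL by (simp add: group_hom_def group_hom_axioms_def)

lemma rho_carrier [simp]: "g \<in> carrier G \<Longrightarrow> \<rho> g \<in> carrier_mat d d"
  using rho_hom GL_simps(3) by (auto simp: hom_def)

lemma rho_mult: "g \<in> carrier G \<Longrightarrow> h \<in> carrier G \<Longrightarrow> \<rho> (g \<otimes> h) = \<rho> g * \<rho> h"
  using rho_hom by (simp add: hom_def GL_simps)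

lemma rho_one: "\<rho> \<one> = 1\<^sub>m d"
  using group_hom.hom_one[OF rho_group_hom] by (simp add: GL_simps)

lemma invariant_subspace:
  assumes "W \<subseteq> carrier_vec d" "0\<^sub>v d \<in> W"
    and "\<And>v w. v \<in> W \<Longrightarrow> w \<in> W \<Longrightarrow> v + w \<in> W"
    and "\<And>c v. v \<in> W \<Longrightarrow> c \<cdot>\<^sub>v v \<in> W"
    and "\<And>g w. g \<in> carrier G \<Longrightarrow> w \<in> W \<Longrightarrow> \<rho> g *\<^sub>v w \<in> W"
  shows "W = {0\<^sub>v d} \<or> W = carrier_vec d"
  using irreducible subspace_module_vecI[OF assms(1-4)] assms(5)
  unfolding irreducible_representation_def by blast

text \<open>
  Schur's lemma: an eigenspace of a matrix commuting with the whole representation is invariant,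
  hence everything.
\<close>

lemma schur:
  assumes T: "T \<in> carrier_mat d d" and comm: "\<And>g. g \<in> carrier G \<Longrightarrow> \<rho> g * T = T * \<rho> g"
  obtains c where "T = c \<cdot>\<^sub>m 1\<^sub>m d"
proof -
  obtain c where "c \<in> spectrum T" using spectrum_non_empty[OF T d_pos] by blast
  then obtain v where v: "v \<in> carrier_vec d" "v \<noteq> 0\<^sub>v d" "T *\<^sub>v v = c \<cdot>\<^sub>v v"
    using T by (auto simp: spectrum_def eigenvalue_def eigenvector_def)
  define W where "W = {w \<in> carrier_vec d. T *\<^sub>v w = c \<cdot>\<^sub>v w}"
  have "W = {0\<^sub>v d} \<or> W = carrier_vec d"
  proof (rule invariant_subspace)
    show "0\<^sub>v d \<in> W" using T by (auto simp: W_def)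
    show "v + w \<in> W" if "v \<in> W" "w \<in> W" for v w
      using that T by (auto simp: W_def mult_add_distrib_mat_vec smult_add_distrib_vec[of v d w])
    show "a \<cdot>\<^sub>v v \<in> W" if "v \<in> W" for a v
      using that T by (simp add: W_def mult_mat_vec smult_smult_assoc mult.commute)
    show "\<rho> g *\<^sub>v w \<in> W" if g: "g \<in> carrier G" and w: "w \<in> W" for g w
    proof -
      have wc: "w \<in> carrier_vec d" and Tw: "T *\<^sub>v w = c \<cdot>\<^sub>v w" using w by (auto simp: W_def)
      have R: "\<rho> g \<in> carrier_mat d d" using g by simp
      have "T *\<^sub>v (\<rho> g *\<^sub>v w) = (T * \<rho> g) *\<^sub>v w"
        by (rule assoc_mult_mat_vec[OF T R wc, symmetric])
      also have "\<dots> = (\<rho> g * T) *\<^sub>v w" using comm[OF g] by simp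
      also have "\<dots> = \<rho> g *\<^sub>v (T *\<^sub>v w)" by (rule assoc_mult_mat_vec[OF R T wc])
      also have "\<dots> = c \<cdot>\<^sub>v (\<rho> g *\<^sub>v w)" unfolding Tw by (rule mult_mat_vec[OF R wc])
      finally show ?thesis using mult_mat_vec_carrier[OF R wc] by (simp add: W_def)
    qed
  qed (auto simp: W_def)
  moreover have "v \<in> W" using v by (simp add: W_def)
  ultimately have "W = carrier_vec d" using v by auto
  then have "T *\<^sub>v w = c \<cdot>\<^sub>v w" if "w \<in> carrier_vec d" for w using that by (auto simp: W_def)
  then show thesis using that eq_smult_one_if_all_eigenvectors[OF T] by blast
qed

text \<open>
  If the matrices commute, they are all scalar by Schur's lemma, so every line is invariant.
\<close>

lemma degree_one_if_commuting:
  assumes comm: "\<And>g h. g \<in> carrier G \<Longrightarrow> h \<in> carrier G \<Longrightarrow> \<rho> g * \<rho> h = \<rho> h * \<rho> g"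
  shows "d = 1"
proof (rule ccontr)
  assume "d \<noteq> 1"
  then have d2: "0 < d" "1 < d" using d_pos by auto
  define W :: "complex vec set" where "W = range (\<lambda>c. c \<cdot>\<^sub>v unit_vec d 0)"
  have "W = {0\<^sub>v d} \<or> W = carrier_vec d"
  proof (rule invariant_subspace)
    show "W \<subseteq> carrier_vec d" by (auto simp: W_def)
    have "0\<^sub>v d = (0::complex) \<cdot>\<^sub>v unit_vec d 0" by auto
    then show "0\<^sub>v d \<in> W" unfolding W_def by blast
    show "v + w \<in> W" if "v \<in> W" "w \<in> W" for v w
      using that by (auto simp: W_def add_smult_distrib_vec[symmetric])
    show "c \<cdot>\<^sub>v v \<in> W" if "v \<in> W" for c v
      using that by (auto simp: W_def smult_smult_assoc)
    show "\<rho> g *\<^sub>v w \<in> W" if g: "g \<in> carrier G" and w: "w \<in> W" for g w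
    proof -
      obtain c where c: "\<rho> g = c \<cdot>\<^sub>m 1\<^sub>m d" using schur[of "\<rho> g"] comm g by auto
      obtain a where a: "w = a \<cdot>\<^sub>v unit_vec d 0" using w by (auto simp: W_def)
      have "\<rho> g *\<^sub>v w = (c * a) \<cdot>\<^sub>v unit_vec d 0"
        unfolding c a by (auto simp: scalar_prod_left_unit)
      then show ?thesis by (simp add: W_def)
    qed
  qed
  moreover have "unit_vec d 0 \<in> W" unfolding W_def by (metis one_smult_vec rangeI)
  moreover have "unit_vec d 0 \<noteq> (0\<^sub>v d :: complex vec)" using d2 by simp
  ultimately have "unit_vec d 1 \<in> W" by auto
  then obtain c :: complex where "unit_vec d 1 = c \<cdot>\<^sub>v unit_vec d 0" by (auto simp: W_def)
  then have "(unit_vec d 1 :: complex vec) $ 1 = (c \<cdot>\<^sub>v unit_vec d 0) $ 1" by simp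
  then show False using d2 by simp
qed

lemma trace_nonzero_if_degree_one:
  assumes "d = 1" "g \<in> carrier G"
  shows "mat_trace (\<rho> g) \<noteq> 0"
proof
  assume tr: "mat_trace (\<rho> g) = 0"
  have R: "\<rho> g \<in> carrier_mat 1 1" "\<rho> (inv g) \<in> carrier_mat 1 1" using assms rho_carrier by auto
  have "\<rho> g * \<rho> (inv g) = 1\<^sub>m 1" using assms by (simp add: rho_mult[symmetric] rho_one)
  then have "(\<rho> g * \<rho> (inv g)) $$ (0, 0) = 1" by simp
  moreover have "\<rho> g $$ (0, 0) = 0" using tr R by (simp add: mat_trace_def)
  ultimately show False using R by (simp add: scalar_prod_def)
qed

lemma central_involution_negative_one:
  assumes x: "x \<in> carrier G" "\<rho> x * \<rho> x = 1\<^sub>m d" "\<rho> x \<noteq> 1\<^sub>m d"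
    and comm: "\<And>g. g \<in> carrier G \<Longrightarrow> \<rho> x * \<rho> g = \<rho> g * \<rho> x"
  shows "\<rho> x = (-1) \<cdot>\<^sub>m 1\<^sub>m d"
proof -
  obtain c where c: "\<rho> x = c \<cdot>\<^sub>m 1\<^sub>m d"
    using schur[OF rho_carrier[OF x(1)] comm[symmetric]] by blast
  have "(\<rho> x * \<rho> x) $$ (0, 0) = (1\<^sub>m d :: complex mat) $$ (0, 0)" by (simp only: x(2))
  moreover have "\<rho> x * \<rho> x = (c * c) \<cdot>\<^sub>m 1\<^sub>m d"
    unfolding c by (rule eq_matI) auto
  ultimately have "c * c = 1" using d_pos by simp
  then have "c = 1 \<or> c = -1" by (simp add: square_eq_1_iff)
  moreover have "c \<noteq> 1" using x(3) c by auto
  ultimately show ?thesis using c by simp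
qed

end

section \<open>Zeros of nonlinear irreducible characters\<close>

text \<open>
  All fibres of a homomorphism over its image are translates of the kernel.
\<close>

lemma (in group_hom) card_preimage:
  assumes fin: "finite (carrier G)" and S: "S \<subseteq> h ` carrier G"
  shows "card {g \<in> carrier G. h g \<in> S} = card (kernel G H h) * card S"
proof -
  have fibre: "card {g \<in> carrier G. h g = y} = card (kernel G H h)" if y: "y \<in> S" for y
  proof -
    obtain a where a: "a \<in> carrier G" "h a = y" using S y by blast
    have "bij_betw (\<lambda>k. a \<otimes> k) (kernel G H h) {g \<in> carrier G. h g = y}"
    proof (rule bij_betwI[where g = "\<lambda>g. inv a \<otimes> g"])
      show "(\<lambda>k. a \<otimes> k) \<in> kernel G H h \<rightarrow> {g \<in> carrier G. h g = y}"
        using a by (auto simp: kernel_def)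
      show "(\<lambda>g. inv a \<otimes> g) \<in> {g \<in> carrier G. h g = y} \<rightarrow> kernel G H h"
        using a by (auto simp: kernel_def)
    qed (use a in \<open>auto simp: kernel_def G.cancel_inv\<close>)
    then show ?thesis by (simp add: bij_betw_same_card)
  qed
  have finS: "finite S" using S fin by (meson finite_imageI finite_subset)
  have "{g \<in> carrier G. h g \<in> S} = (\<Union>y\<in>S. {g \<in> carrier G. h g = y})" by blast
  then have "card {g \<in> carrier G. h g \<in> S} = card (\<Union>y\<in>S. {g \<in> carrier G. h g = y})" by simp
  also have "\<dots> = (\<Sum>y\<in>S. card {g \<in> carrier G. h g = y})"
    using finS fin by (intro card_UN_disjoint) auto
  also have "\<dots> = (\<Sum>y\<in>S. card (kernel G H h))" using fibre by (intro sum.cong) auto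
  finally show ?thesis by (simp add: mult.commute)
qed

context irreducible_rep
begin

text \<open>
  The character of a faithful irreducible representation vanishes on the twisted elements, so the
  count of the latter transfers to the zeros.
\<close>

lemma zeros_of_faithful:
  assumes ordG: "Coset.order G = 2 ^ n" and inj: "inj_on \<rho> (carrier G)" and d: "d \<noteq> 1"
  shows "card {g \<in> carrier G. mat_trace (\<rho> g) = 0} \<ge> 2 ^ (n - 1) + 2"
    and "card {g \<in> carrier G. mat_trace (\<rho> g) = 0} = 2 ^ (n - 1) + 2 \<Longrightarrow>
      dihedral_2_group G \<or> semidihedral_2_group G \<or> generalized_quaternion_group G"
proof -
  have "\<exists>x\<in>carrier G. \<exists>y\<in>carrier G. \<rho> x * \<rho> y \<noteq> \<rho> y * \<rho> x"
    using degree_one_if_commuting d by blast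
  then have nonab: "\<exists>x\<in>carrier G. \<exists>y\<in>carrier G. x \<otimes> y \<noteq> y \<otimes> x"
    using rho_mult by metis
  have "carrier G \<noteq> {\<one>}"
  proof
    assume "carrier G = {\<one>}"
    with nonab show False by simp
  qed
  then have nontrivial: "{\<one>} \<subset> carrier G" using one_closed by blast
  have normal: "carrier G \<lhd> G" by (intro normal_invI subgroup_self) auto
  obtain z where z: "z \<in> carrier G - {\<one>}" "z \<otimes> z \<in> {\<one>}"
    and z_comm': "\<forall>g\<in>carrier G. \<exists>u\<in>{\<one>}. g \<otimes> z = u \<otimes> z \<otimes> g"
    using two_group_central_mod_normal[OF ordG one_is_normal normal nontrivial] by (elim bexE conjE)
  have zc [simp]: "z \<in> carrier G" and z_ne: "z \<noteq> \<one>" and zz: "z \<otimes> z = \<one>" using z by auto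
  have z_comm: "z \<otimes> g = g \<otimes> z" if "g \<in> carrier G" for g using z_comm' that by simp
  have negative: "\<rho> x = (-1) \<cdot>\<^sub>m 1\<^sub>m d"
    if x: "x \<in> carrier G" "x \<otimes> x = \<one>" "x \<noteq> \<one>" and x_comm: "\<And>g. g \<in> carrier G \<Longrightarrow> x \<otimes> g = g \<otimes> x" for x
  proof (rule central_involution_negative_one[OF x(1)])
    show "\<rho> x * \<rho> x = 1\<^sub>m d" using x by (simp add: rho_mult[symmetric] rho_one)
    show "\<rho> x \<noteq> 1\<^sub>m d" using x(1,3) inj rho_one by (metis inj_on_eq_iff one_closed)
    show "\<rho> x * \<rho> g = \<rho> g * \<rho> x" if "g \<in> carrier G" for g
      using x_comm[OF that] x(1) that by (simp add: rho_mult[symmetric])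
  qed
  have rho_z: "\<rho> z = (-1) \<cdot>\<^sub>m 1\<^sub>m d" by (rule negative[OF zc zz z_ne z_comm])
  interpret two_group_one_central_involution G n z
  proof (intro two_group_one_central_involution.intro two_group_one_central_involution_axioms.intro)
    show "x = \<one> \<or> x = z"
      if x: "x \<in> carrier G" "x \<otimes> x = \<one>" "\<And>g. g \<in> carrier G \<Longrightarrow> x \<otimes> g = g \<otimes> x" for x
    proof (cases "x = \<one>")
      case False
      then have "\<rho> x = \<rho> z" using negative[OF x(1,2) _ x(3)] rho_z by simp
      then show ?thesis using inj_onD[OF inj] x(1) zc by blast
    qed simp
  qed (fact is_group ordG zc z_ne zz z_comm nonab)+
  have zeros: "twisted \<subseteq> {g \<in> carrier G. mat_trace (\<rho> g) = 0}"
  proof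
    fix g assume "g \<in> twisted"
    then obtain h where gh: "g \<in> carrier G" "h \<in> carrier G" "h \<otimes> g = z \<otimes> g \<otimes> h"
      by (auto simp: twisted_def)
    have prod: "\<rho> g * \<rho> h \<in> carrier_mat d d"
      using gh(1,2) by (intro mult_carrier_mat[of _ d d _ d]) auto
    have "\<rho> h * \<rho> g = \<rho> z * (\<rho> g * \<rho> h)"
      using gh by (simp add: rho_mult[symmetric] m_assoc)
    also have "\<dots> = (-1) \<cdot>\<^sub>m (1\<^sub>m d * (\<rho> g * \<rho> h))"
      unfolding rho_z using prod by (intro mult_smult_assoc_mat[of _ d d _ d]) auto
    also have "1\<^sub>m d * (\<rho> g * \<rho> h) = \<rho> g * \<rho> h" by (rule left_mult_one_mat[OF prod])
    finally have "mat_trace (\<rho> g) = 0"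
      using gh(1,2) by (intro mat_trace_zero_if_conjugate_to_negative[of _ d "\<rho> h" "\<rho> (inv h)"])
        (auto simp: rho_mult[symmetric] rho_one)
    then show "g \<in> {g \<in> carrier G. mat_trace (\<rho> g) = 0}" using gh by simp
  qed
  have fin: "finite {g \<in> carrier G. mat_trace (\<rho> g) = 0}" using finite_carrier by simp
  have le: "card twisted \<le> card {g \<in> carrier G. mat_trace (\<rho> g) = 0}" using zeros fin by (rule card_mono[rotated])
  show "card {g \<in> carrier G. mat_trace (\<rho> g) = 0} \<ge> 2 ^ (n - 1) + 2"
    using card_twisted(1) le by (rule le_trans)
  assume "card {g \<in> carrier G. mat_trace (\<rho> g) = 0} = 2 ^ (n - 1) + 2"
  then have "card twisted = 2 ^ (n - 1) + 2" using card_twisted(1) le by simp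
  then show "dihedral_2_group G \<or> semidihedral_2_group G \<or> generalized_quaternion_group G"
    by (rule card_twisted(2))
qed

text \<open>
  The image of a representation is a matrix group that acts irreducibly by its inclusion; this is
  the faithful representation to which the general case is reduced.
\<close>

lemma irreducible_image:
  "irreducible_rep ((GL d)\<lparr>carrier := \<rho> ` carrier G\<rparr>) d (\<lambda>A. A)"
proof -
  interpret hom: group_hom G "GL d" \<rho> by (rule rho_group_hom)
  have sub: "subgroup (\<rho> ` carrier G) (GL d)" by (rule hom.img_is_subgroup)
  have "irreducible_representation ((GL d)\<lparr>carrier := \<rho> ` carrier G\<rparr>) d (\<lambda>A. A)"
    using irreducible subgroup.subset[OF sub]
    unfolding irreducible_representation_def representation_def hom_def by auto
  then show ?thesis
    using subgroup.subgroup_is_group[OF sub group_GL]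
    by (simp add: irreducible_rep_def irreducible_rep_axioms_def)
qed

text \<open>
  The zeros form the preimage of the zeros of the image group. With a kernel of order \<open>k\<close> the
  excess of the number of zeros over \<open>2 ^ (n - 1)\<close> is therefore at least \<open>2 * k\<close>, so that
  equality forces the representation to be faithful.
\<close>

lemma zeros_of_nonlinear:
  assumes ordG: "Coset.order G = 2 ^ n" and d: "d \<noteq> 1"
  shows "card {g \<in> carrier G. mat_trace (\<rho> g) = 0} \<ge> 2 ^ (n - 1) + 2"
    and "card {g \<in> carrier G. mat_trace (\<rho> g) = 0} = 2 ^ (n - 1) + 2 \<Longrightarrow>
      dihedral_2_group G \<or> semidihedral_2_group G \<or> generalized_quaternion_group G"
proof -
  interpret hom: group_hom G "GL d" \<rho> by (rule rho_group_hom)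
  have fin: "finite (carrier G)" by (rule finite_carrier_of_order_two_power[OF ordG])
  define Im where "Im = (GL d)\<lparr>carrier := \<rho> ` carrier G\<rparr>"
  interpret I: irreducible_rep Im d "\<lambda>A. A" unfolding Im_def by (rule irreducible_image)
  define k where "k = card (kernel G (GL d) \<rho>)"
  have "card {g \<in> carrier G. \<rho> g \<in> \<rho> ` carrier G} = k * card (\<rho> ` carrier G)"
    unfolding k_def using fin by (rule hom.card_preimage) simp
  moreover have "{g \<in> carrier G. \<rho> g \<in> \<rho> ` carrier G} = carrier G" by auto
  ultimately have order_split: "2 ^ n = k * card (\<rho> ` carrier G)"
    using ordG by (simp add: Coset.order_def)
  obtain m where m: "card (\<rho> ` carrier G) = 2 ^ m"
    using order_split divides_primepow_nat[OF two_is_prime_nat, of "card (\<rho> ` carrier G)" n]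
    by (metis dvd_triv_right)
  then have ordI: "Coset.order Im = 2 ^ m" by (simp add: Im_def Coset.order_def)
  define zerosI where "zerosI = {A \<in> carrier Im. mat_trace A = 0}"
  have inj: "inj_on (\<lambda>A. A) (carrier Im)" by simp
  have zerosI: "card zerosI \<ge> 2 ^ (m - 1) + 2"
    unfolding zerosI_def by (rule I.zeros_of_faithful(1)[OF ordI inj d])
  have m_pos: "m \<noteq> 0"
  proof
    assume "m = 0"
    then have "card (carrier Im) = 1" using ordI by (simp add: Coset.order_def)
    moreover have "card zerosI \<le> card (carrier Im)"
      using fin by (intro card_mono) (auto simp: zerosI_def Im_def)
    ultimately show False using zerosI by simp
  qed
  have "k \<noteq> 0"
  proof
    assume "k = 0"
    with order_split show False by simp
  qed
  then have k_pos: "k \<ge> 1" by simp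
  have "{g \<in> carrier G. mat_trace (\<rho> g) = 0} = {g \<in> carrier G. \<rho> g \<in> zerosI}"
    by (auto simp: zerosI_def Im_def)
  then have zeros_split: "card {g \<in> carrier G. mat_trace (\<rho> g) = 0} = k * card zerosI"
    unfolding k_def using hom.card_preimage[OF fin, of zerosI] by (auto simp: zerosI_def Im_def)
  obtain m' where m': "m = Suc m'" using not0_implies_Suc[OF m_pos] by (elim exE)
  have double: "2 ^ n = 2 * (k * 2 ^ (m - 1))" using order_split m by (simp add: m')
  have half: "2 ^ (n - 1) = k * 2 ^ (m - 1)"
  proof (cases n)
    case 0
    have "1 \<le> k * 2 ^ (m - 1)" using k_pos by simp
    then have "2 * 1 \<le> (2::nat) ^ n" unfolding double by (rule mult_le_mono2)
    then show ?thesis using 0 by simp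
  next
    case (Suc n')
    then show ?thesis using double by simp
  qed
  have "k * (2 ^ (m - 1) + 2) \<le> k * card zerosI" using zerosI by (rule mult_le_mono2)
  then have bound: "2 ^ (n - 1) + 2 * k \<le> card {g \<in> carrier G. mat_trace (\<rho> g) = 0}"
    using zeros_split half by (simp add: distrib_left mult.commute)
  then show "card {g \<in> carrier G. mat_trace (\<rho> g) = 0} \<ge> 2 ^ (n - 1) + 2"
    using k_pos by linarith
  assume eq: "card {g \<in> carrier G. mat_trace (\<rho> g) = 0} = 2 ^ (n - 1) + 2"
  then have "k = 1" using bound k_pos by linarith
  then have "card (kernel G (GL d) \<rho>) = 1" by (simp add: k_def)
  then obtain e where "kernel G (GL d) \<rho> = {e}" by (rule card_1_singletonE)
  moreover have "\<one> \<in> kernel G (GL d) \<rho>" by (rule subgroup.one_closed[OF hom.subgroup_kernel])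
  ultimately have "kernel G (GL d) \<rho> = {\<one>}" by simp
  then have "inj_on \<rho> (carrier G)" using hom.inj_iff_trivial_ker by blast
  then show "dihedral_2_group G \<or> semidihedral_2_group G \<or> generalized_quaternion_group G"
    using zeros_of_faithful(2)[OF ordG _ d eq] by blast
qed

end

section \<open>Representations induced from a subgroup of index two\<close>

lemma carrier_vec_two_decomp:
  fixes v :: "complex vec"
  assumes "v \<in> carrier_vec 2"
  shows "v = (v $ 0) \<cdot>\<^sub>v unit_vec 2 0 + (v $ 1) \<cdot>\<^sub>v unit_vec 2 1"
proof (rule eq_vecI)
  fix i assume "i < dim_vec ((v $ 0) \<cdot>\<^sub>v unit_vec 2 0 + (v $ 1) \<cdot>\<^sub>v unit_vec 2 1 :: complex vec)"
  then have "i = 0 \<or> i = 1" by auto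
  then show "v $ i = ((v $ 0) \<cdot>\<^sub>v unit_vec 2 0 + (v $ 1) \<cdot>\<^sub>v unit_vec 2 1) $ i" by auto
qed (use assms in auto)

text \<open>
  A linear character of a subgroup of index two. The matrices of the induced representation are
  written down for the transversal \<open>\<one>\<close>, \<open>t\<close> by means of the extension of the character by zero.
\<close>

locale index_two_character = index_two_subgroup +
  fixes \<theta> :: "'a \<Rightarrow> complex"
  assumes char_mult: "x \<in> M \<Longrightarrow> y \<in> M \<Longrightarrow> \<theta> (x \<otimes> y) = \<theta> x * \<theta> y"
    and char_one: "\<theta> \<one> = 1"
begin

definition ext :: "'a \<Rightarrow> complex" where
  "ext x = (if x \<in> M then \<theta> x else 0)"

definition transversal :: "nat \<Rightarrow> 'a" where
  "transversal i = (if i = 0 then \<one> else t)"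

definition induced :: "'a \<Rightarrow> complex mat" where
  "induced g = mat 2 2 (\<lambda>(i, j). ext (transversal i \<otimes> g \<otimes> inv (transversal j)))"

lemma transversal_closed [simp]: "transversal i \<in> carrier G"
  by (simp add: transversal_def)

lemma inv_t_notin: "inv t \<notin> M"
  using t_notin by (simp add: inv_mem_iff)

text \<open>
  Exactly one of \<open>g\<close> and \<open>g \<otimes> inv t\<close> lies in \<open>M\<close>, so exactly one summand can differ from zero.
  This identity is the multiplicativity of the induced representation, entry by entry.
\<close>

lemma ext_mult:
  assumes "g \<in> carrier G" "h \<in> carrier G"
  shows "ext (g \<otimes> h) = ext g * ext h + ext (g \<otimes> inv t) * ext (t \<otimes> h)"
proof (cases "g \<in> M")
  case True
  then show ?thesis using assms inv_t_notin by (simp add: ext_def mult_mem_iff char_mult)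
next
  case False
  have eq: "(g \<otimes> inv t) \<otimes> (t \<otimes> h) = g \<otimes> h" using assms by (simp add: m_assoc cancel_inv)
  show ?thesis
  proof (cases "h \<in> M")
    case True
    then show ?thesis using False assms t_notin by (simp add: ext_def mult_mem_iff)
  next
    case h: False
    have "g \<otimes> inv t \<in> M" "t \<otimes> h \<in> M" using False h assms t_notin by (auto simp: mult_mem_iff inv_mem_iff)
    then have "\<theta> (g \<otimes> h) = \<theta> (g \<otimes> inv t) * \<theta> (t \<otimes> h)" using char_mult eq by metis
    then show ?thesis using False h assms t_notin by (simp add: ext_def mult_mem_iff inv_mem_iff)
  qed
qed

lemma induced_carrier [simp]: "induced g \<in> carrier_mat 2 2"
  by (simp add: induced_def)

lemma induced_index:
  "i < 2 \<Longrightarrow> j < 2 \<Longrightarrow> induced g $$ (i, j) = ext (transversal i \<otimes> g \<otimes> inv (transversal j))"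
  by (simp add: induced_def)

lemma induced_mult:
  assumes g: "g \<in> carrier G" and h: "h \<in> carrier G"
  shows "induced (g \<otimes> h) = induced g * induced h"
proof (rule eq_matI)
  fix i j assume "i < dim_row (induced g * induced h)" "j < dim_col (induced g * induced h)"
  then have ij: "i < 2" "j < 2" by (auto simp: induced_def)
  let ?x = "transversal i \<otimes> g" and ?y = "h \<otimes> inv (transversal j)"
  have "(induced g * induced h) $$ (i, j) = (\<Sum>k<2. induced g $$ (i, k) * induced h $$ (k, j))"
    using ij by (simp add: scalar_prod_def atLeast0LessThan induced_def)
  also have "\<dots> = induced g $$ (i, 0) * induced h $$ (0, j) + induced g $$ (i, 1) * induced h $$ (1, j)"
    by (simp add: numeral_2_eq_2)
  also have "\<dots> = ext ?x * ext ?y + ext (?x \<otimes> inv t) * ext (t \<otimes> ?y)"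
    using ij g h by (simp add: induced_index m_assoc) (simp add: transversal_def)
  also have "\<dots> = ext (?x \<otimes> ?y)" using g h by (intro ext_mult[symmetric]) auto
  also have "\<dots> = induced (g \<otimes> h) $$ (i, j)" using ij g h by (simp add: induced_index m_assoc)
  finally show "induced (g \<otimes> h) $$ (i, j) = (induced g * induced h) $$ (i, j)" by simp
qed (auto simp: induced_def)

lemma induced_one: "induced \<one> = 1\<^sub>m 2"
proof (rule eq_matI)
  fix i j assume "i < dim_row (1\<^sub>m 2 :: complex mat)" "j < dim_col (1\<^sub>m 2 :: complex mat)"
  then have "i < 2" "j < 2" "i = 0 \<or> i = 1" "j = 0 \<or> j = 1" by auto
  then show "induced \<one> $$ (i, j) = 1\<^sub>m 2 $$ (i, j)"
    using t_notin inv_t_notin by (auto simp: induced_index transversal_def ext_def char_one)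
qed (auto simp: induced_def)

lemma induced_hom: "induced \<in> hom G (GL 2)"
proof (rule homI)
  fix g assume g: "g \<in> carrier G"
  have "induced g * induced (inv g) = 1\<^sub>m 2" "induced (inv g) * induced g = 1\<^sub>m 2"
    using g by (simp_all add: induced_mult[symmetric] induced_one)
  then show "induced g \<in> carrier (GL 2)"
    by (auto simp: GL_def units_of_carrier Units_def ring_mat_simps intro!: bexI[of _ "induced (inv g)"])
qed (simp add: induced_mult GL_simps)

lemma mat_trace_induced:
  "g \<in> carrier G \<Longrightarrow> mat_trace (induced g) = ext g + ext (t \<otimes> g \<otimes> inv t)"
  by (simp add: mat_trace_def induced_def numeral_2_eq_2 transversal_def)

text \<open>
  Irreducibility when the character differs from its conjugate: \<open>r\<close> acts diagonally with two
  different eigenvalues, so a nonzero invariant subspace contains a coordinate vector, and \<open>t\<close>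
  exchanges the two coordinate lines.
\<close>

lemma induced_irreducible:
  assumes r: "r \<in> M" and distinct: "\<theta> r \<noteq> \<theta> (t \<otimes> r \<otimes> inv t)"
  shows "irreducible_representation G 2 induced"
  unfolding irreducible_representation_def representation_def
proof (intro conjI allI impI)
  show "induced \<in> hom G (GL 2)" by (rule induced_hom)
  fix W assume "VectorSpace.subspace class_ring W (module_vec TYPE(complex) 2) \<and>
      (\<forall>g\<in>carrier G. \<forall>w\<in>W. induced g *\<^sub>v w \<in> W)"
  then have W_sub: "W \<subseteq> carrier_vec 2" and W0: "0\<^sub>v 2 \<in> W"
    and W_add: "\<And>v w. v \<in> W \<Longrightarrow> w \<in> W \<Longrightarrow> v + w \<in> W"
    and W_smult: "\<And>c v. v \<in> W \<Longrightarrow> c \<cdot>\<^sub>v v \<in> W"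
    and W_inv: "\<And>g w. g \<in> carrier G \<Longrightarrow> w \<in> W \<Longrightarrow> induced g *\<^sub>v w \<in> W"
    by (auto simp: VectorSpace.subspace_def submodule_def module_vec_simps)
  have image: "induced g *\<^sub>v v = vec 2 (\<lambda>i. induced g $$ (i, 0) * v $ 0 + induced g $$ (i, 1) * v $ 1)"
    if "v \<in> carrier_vec 2" for g v
    using that by (intro eq_vecI) (auto simp: scalar_prod_def induced_def numeral_2_eq_2)
  have rc [simp]: "r \<in> carrier G" using r by simp
  have tt: "t \<otimes> t \<in> M" using t_notin by (simp add: mult_mem_iff)
  have theta_tt: "\<theta> (t \<otimes> t) \<noteq> 0"
  proof -
    have "\<theta> (t \<otimes> t) * \<theta> (inv (t \<otimes> t)) = 1"
      using tt char_mult[of "t \<otimes> t" "inv (t \<otimes> t)"] char_one by simp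
    then show ?thesis by auto
  qed
  have at_t: "induced t $$ (0, 0) = 0" "induced t $$ (0, 1) = 1"
      "induced t $$ (1, 0) = \<theta> (t \<otimes> t)" "induced t $$ (1, 1) = 0"
    using t_notin tt by (simp_all add: induced_index transversal_def ext_def char_one m_assoc)
  have at_r: "induced r $$ (0, 0) = \<theta> r" "induced r $$ (0, 1) = 0"
      "induced r $$ (1, 0) = 0" "induced r $$ (1, 1) = \<theta> (t \<otimes> r \<otimes> inv t)"
    using t_notin r inv_t_notin by (simp_all add: induced_index transversal_def ext_def mult_mem_iff)
  have e0_from_e1: "unit_vec 2 0 \<in> W" if "unit_vec 2 1 \<in> W"
  proof -
    have "induced t *\<^sub>v unit_vec 2 1 = unit_vec 2 0"
      by (subst image) (auto simp: at_t[unfolded One_nat_def] less_2_cases_iff intro!: eq_vecI)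
    then show ?thesis using W_inv[OF t_closed that] by simp
  qed
  have e1_from_e0: "unit_vec 2 1 \<in> W" if "unit_vec 2 0 \<in> W"
  proof -
    have "(1 / \<theta> (t \<otimes> t)) \<cdot>\<^sub>v (induced t *\<^sub>v unit_vec 2 0) = unit_vec 2 1"
    proof (subst image)
      show "(1 / \<theta> (t \<otimes> t)) \<cdot>\<^sub>v vec 2 (\<lambda>i. induced t $$ (i, 0) * unit_vec 2 0 $ 0 + induced t $$ (i, 1) * unit_vec 2 0 $ 1)
          = unit_vec 2 1"
      proof (rule eq_vecI)
        fix i assume "i < dim_vec (unit_vec 2 1 :: complex vec)"
        then have "i = 0 \<or> i = 1" by auto
        then show "((1 / \<theta> (t \<otimes> t)) \<cdot>\<^sub>v vec 2 (\<lambda>i. induced t $$ (i, 0) * unit_vec 2 0 $ 0 + induced t $$ (i, 1) * unit_vec 2 0 $ 1)) $ i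
            = unit_vec 2 1 $ i"
          using theta_tt by (auto simp: at_t[unfolded One_nat_def])
      qed simp
    qed simp
    then show ?thesis using W_smult[OF W_inv[OF t_closed that]] by metis
  qed
  have whole: "W = carrier_vec 2" if e: "unit_vec 2 0 \<in> W" "unit_vec 2 1 \<in> W"
  proof
    show "carrier_vec 2 \<subseteq> W"
    proof
      fix v :: "complex vec" assume "v \<in> carrier_vec 2"
      then have "v = (v $ 0) \<cdot>\<^sub>v unit_vec 2 0 + (v $ 1) \<cdot>\<^sub>v unit_vec 2 1"
        by (rule carrier_vec_two_decomp)
      moreover have "(v $ 0) \<cdot>\<^sub>v unit_vec 2 0 + (v $ 1) \<cdot>\<^sub>v unit_vec 2 1 \<in> W"
        using W_add W_smult e by blast
      ultimately show "v \<in> W" by simp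
    qed
  qed (rule W_sub)
  show "W = {0\<^sub>v 2} \<or> W = carrier_vec 2"
  proof (cases "W = {0\<^sub>v 2}")
    case False
    then obtain w where w: "w \<in> W" "w \<noteq> 0\<^sub>v 2" using W0 by blast
    have wc: "w \<in> carrier_vec 2" using w W_sub by blast
    show ?thesis
    proof (cases "w $ 0 = 0")
      case True
      have "w $ 1 \<noteq> 0"
      proof
        assume "w $ 1 = 0"
        then have "w = 0\<^sub>v 2" using wc True by (intro eq_vecI) (auto simp: less_2_cases_iff)
        then show False using w by simp
      qed
      then have "(1 / w $ 1) \<cdot>\<^sub>v w = unit_vec 2 1"
        using True by (subst carrier_vec_two_decomp[OF wc]) (auto intro!: eq_vecI)
      then have "unit_vec 2 1 \<in> W" using W_smult[OF w(1)] by metis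
      then show ?thesis using whole e0_from_e1 by blast
    next
      case w0: False
      define q where "q = \<theta> r - \<theta> (t \<otimes> r \<otimes> inv t)"
      have q: "q \<noteq> 0" using distinct by (simp add: q_def)
      \<comment> \<open>Subtracting the second eigenvalue removes the second coordinate of \<open>w\<close>.\<close>
      define u where "u = induced r *\<^sub>v w + (- \<theta> (t \<otimes> r \<otimes> inv t)) \<cdot>\<^sub>v w"
      have "u \<in> W" unfolding u_def by (intro W_add W_smult W_inv w rc)
      moreover have "(1 / (q * w $ 0)) \<cdot>\<^sub>v u = unit_vec 2 0"
      proof (rule eq_vecI)
        fix i assume "i < dim_vec (unit_vec 2 0 :: complex vec)"
        then have "i = 0 \<or> i = 1" by auto
        then show "((1 / (q * w $ 0)) \<cdot>\<^sub>v u) $ i = unit_vec 2 0 $ i"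
          unfolding u_def image[OF wc] using wc w0 q
          by (auto simp: at_r[unfolded One_nat_def] q_def field_simps)
      qed (use wc in \<open>simp add: u_def\<close>)
      ultimately have "unit_vec 2 0 \<in> W" using W_smult by metis
      then show ?thesis using whole e1_from_e0 by blast
    qed
  qed simp
qed simp

end

section \<open>A character attaining the bound\<close>

text \<open>
  The relations allow every word in \<open>r\<close> and \<open>s\<close> to be rewritten as a power of \<open>r\<close>, possibly
  followed by one \<open>s\<close>. As the group has \<open>2 ^ k\<close> elements and there are at most \<open>2 ^ (k - 1)\<close> powers
  of \<open>r\<close>, the order of \<open>r\<close> is as large as its relation permits and \<open>s\<close> is not a power of \<open>r\<close>.
\<close>

lemma (in group) index_two_subgroup_of_presentation:
  assumes ordG: "Coset.order G = 2 ^ k" and k: "k \<ge> 3"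
    and r: "r \<in> carrier G" and s: "s \<in> carrier G" and gen: "generate G {r, s} = carrier G"
    and r_pow: "r [^] (2 ^ (k - 1) :: nat) = \<one>" and ss: "s \<otimes> s = r [^] (l :: nat)"
    and conj: "s \<otimes> r \<otimes> inv s = r [^] (i :: nat)"
  shows "index_two_subgroup G (range (\<lambda>a::nat. r [^] a)) s" and "ord r = 2 ^ (k - 1)"
    and "\<And>a::nat. s \<otimes> r [^] a \<otimes> inv s = r [^] (i * a)"
proof -
  define P where "P = range (\<lambda>a::nat. r [^] a)"
  have ord_dvd: "ord r dvd 2 ^ (k - 1)" using r_pow pow_eq_id[OF r] by blast
  then have ord_le: "ord r \<le> 2 ^ (k - 1)" by (rule dvd_imp_le) simp
  have ord_ne: "ord r \<noteq> 0"
  proof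
    assume "ord r = 0"
    with ord_dvd show False by simp
  qed
  have P_gen: "P = generate G {r}"
    using generate_pow_nat[OF r ord_ne] by (simp add: P_def full_SetCompr_eq)
  have subP: "subgroup P G" unfolding P_gen using r by (intro generate_is_subgroup) auto
  interpret P: subgroup P G by (rule subP)
  have Pc [simp]: "p \<in> carrier G" if "p \<in> P" for p using that by (rule P.mem_carrier)
  have rP: "r \<in> P" unfolding P_gen by (rule generate.incl) simp
  have ssP: "s \<otimes> s \<in> P" by (auto simp: ss P_def)
  have s_pow: "s \<otimes> r [^] a = r [^] (i * a) \<otimes> s" for a :: nat
  proof (induction a)
    case (Suc a)
    have sr: "s \<otimes> r = r [^] i \<otimes> s"
    proof -
      have "s \<otimes> r = (s \<otimes> r \<otimes> inv s) \<otimes> s" using r s by (simp add: m_assoc)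
      then show ?thesis by (simp only: conj)
    qed
    have "s \<otimes> r [^] Suc a = (s \<otimes> r [^] a) \<otimes> r" using r s by (simp add: m_assoc)
    also have "\<dots> = r [^] (i * a) \<otimes> (s \<otimes> r)" unfolding Suc.IH using r s by (simp add: m_assoc)
    also have "\<dots> = (r [^] (i * a) \<otimes> r [^] i) \<otimes> s" unfolding sr using r s by (simp add: m_assoc)
    also have "r [^] (i * a) \<otimes> r [^] i = r [^] (i * a + i)" by (rule nat_pow_mult[OF r])
    also have "i * a + i = i * Suc a" by simp
    finally show ?case .
  qed (use r s in simp)
  have s_comm: "\<exists>q\<in>P. s \<otimes> p = q \<otimes> s" if "p \<in> P" for p
    using that s_pow by (auto simp: P_def)
  have cover: "g \<in> P \<or> g \<otimes> inv s \<in> P" if "g \<in> generate G {r, s}" for g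
    using that
  proof (induction rule: generate.induct)
    case (incl h)
    then show ?case using rP s by auto
  next
    case (inv h)
    have "inv s \<otimes> inv s \<in> P" using P.m_inv_closed[OF ssP] s by (simp add: inv_mult_group)
    then show ?case using inv rP by auto
  next
    case (eng g h)
    have cg: "g \<in> carrier G" "h \<in> carrier G" using eng gen by auto
    show ?case
    proof (cases "g \<in> P")
      case True
      then have "g \<otimes> h \<otimes> inv s = g \<otimes> (h \<otimes> inv s)" using cg s by (simp add: m_assoc)
      then show ?thesis using True eng by auto
    next
      case False
      define p where "p = g \<otimes> inv s"
      have p: "p \<in> P" "g = p \<otimes> s" using False eng cg s by (auto simp: p_def m_assoc)
      show ?thesis
      proof (cases "h \<in> P")
        case True
        then obtain q where q: "q \<in> P" "s \<otimes> h = q \<otimes> s" using s_comm by blast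
        have "g \<otimes> h = p \<otimes> (s \<otimes> h)" using p s cg by (simp add: m_assoc)
        also have "\<dots> = (p \<otimes> q) \<otimes> s" unfolding q(2) using p(1) q(1) s by (simp add: m_assoc)
        finally have "g \<otimes> h \<otimes> inv s = p \<otimes> q" using p(1) q(1) s by (simp add: m_assoc)
        then show ?thesis using p q by simp
      next
        case h: False
        define h' where "h' = h \<otimes> inv s"
        have h': "h' \<in> P" "h = h' \<otimes> s" using h eng cg s by (auto simp: h'_def m_assoc)
        obtain q where q: "q \<in> P" "s \<otimes> h' = q \<otimes> s" using s_comm h' by blast
        have "g \<otimes> h = p \<otimes> (s \<otimes> h') \<otimes> s" using p(1) h'(1) s by (simp add: p(2) h'(2) m_assoc)
        also have "\<dots> = (p \<otimes> q) \<otimes> (s \<otimes> s)" unfolding q(2) using p(1) q(1) s by (simp add: m_assoc)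
        finally show ?thesis using p(1) q(1) ssP by simp
      qed
    qed
  qed simp
  have cardP: "card P = ord r" using generate_pow_card[OF r] by (simp add: P_gen)
  have "s \<notin> P"
  proof
    assume sP: "s \<in> P"
    have "g \<in> P" if g: "g \<in> carrier G" for g
    proof -
      have "g \<in> P \<or> g \<otimes> inv s \<in> P" using cover g gen by simp
      moreover have "g = (g \<otimes> inv s) \<otimes> s" using g s by (simp add: m_assoc)
      ultimately show ?thesis using sP P.m_closed by metis
    qed
    then have "P = carrier G" using P.subset by blast
    then have "card P = 2 ^ k" using ordG by (simp only: Coset.order_def)
    then have "2 ^ k \<le> (2::nat) ^ (k - 1)" using cardP ord_le by (simp only:)
    moreover have "(2::nat) ^ (k - 1) < 2 ^ k" using k by (intro power_strict_increasing) auto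
    ultimately show False by (meson linorder_not_le)
  qed
  then have idx: "index_two_subgroup G P s"
    using cover s gen
    by (intro index_two_subgroup.intro index_two_subgroup_axioms.intro is_group subP) auto
  then show "index_two_subgroup G (range (\<lambda>a::nat. r [^] a)) s" by (simp add: P_def)
  show "ord r = 2 ^ (k - 1)" using index_two_subgroup.card_outside(1)[OF idx ordG] cardP by simp
  show "s \<otimes> r [^] a \<otimes> inv s = r [^] (i * a)" for a :: nat
    using s_pow[of a] r s by (simp add: m_assoc)
qed

lemma root_of_unity_power_eq_iff:
  fixes N :: nat
  assumes N: "N > 0"
  shows "cis (2 * pi / N) ^ a = cis (2 * pi / N) ^ b \<longleftrightarrow> a mod N = b mod N"
proof -
  have power: "cis (2 * pi / N) ^ a = cis (2 * pi * real (a mod N) / real N)" for a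
  proof -
    have "cis (2 * pi / N) ^ N = cis (2 * pi)" using N by (simp add: DeMoivre)
    then have one: "cis (2 * pi / N) ^ N = 1" by (simp add: complex_eq_iff)
    have "cis (2 * pi / N) ^ a = cis (2 * pi / N) ^ (N * (a div N) + a mod N)" by simp
    also have "\<dots> = cis (2 * pi / N) ^ (a mod N)" by (simp only: power_add power_mult one power_one mult_1)
    finally show ?thesis by (simp add: DeMoivre mult.commute)
  qed
  have "inj_on (\<lambda>k. cis (2 * pi * real k / real N)) {..<N}"
    using bij_betw_roots_unity[OF N] by (rule bij_betw_imp_inj_on)
  then show ?thesis unfolding power using N by (auto dest: inj_onD)
qed

text \<open>
  The three families are treated together: \<open>s\<close> raises \<open>r\<close> to a power \<open>i\<close> that is \<open>3\<close> modulo \<open>4\<close>.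
  Inducing a faithful character of the cyclic subgroup gives a character whose value at \<open>r [^] a\<close>
  is \<open>\<zeta> ^ a + \<zeta> ^ (i * a)\<close>. The exponents \<open>a\<close>, \<open>b\<close> of two zeros in the subgroup satisfy
  \<open>(i - 1) * (a - b) \<equiv> 0\<close> modulo \<open>N\<close>, and \<open>i - 1\<close> is twice an odd number, so \<open>a\<close> and \<open>b\<close> agree
  modulo \<open>N / 2\<close> and there are at most two zeros in the subgroup. The opposite bound holds for
  every nonlinear irreducible character.
\<close>

lemma exists_irr_with_few_zeros:
  fixes G (structure)
  assumes G: "group G" and ordG: "Coset.order G = 2 ^ k" and k: "k \<ge> 3"
    and r: "r \<in> carrier G" and s: "s \<in> carrier G" and gen: "generate G {r, s} = carrier G"
    and r_pow: "r [^] (2 ^ (k - 1) :: nat) = \<one>" and ss: "s \<otimes> s = r [^] (l :: nat)"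
    and conj: "s \<otimes> r \<otimes> inv s = r [^] (i :: nat)" and i: "i mod 4 = 3"
  shows "\<exists>\<chi>\<in>Irr G. card (vanishing_set G \<chi>) = 2 ^ (k - 1) + 2"
proof -
  interpret group G by fact
  define N :: nat where "N = 2 ^ (k - 1)"
  define H :: nat where "H = 2 ^ (k - 2)"
  have N_H: "N = 2 * H" and H_even: "even H" and N_pos: "N > 0"
    using k by (auto simp: N_def H_def power_Suc[symmetric] Suc_diff_Suc numeral_2_eq_2 simp del: power_Suc)
  define \<zeta> where "\<zeta> = cis (2 * pi / N)"
  have \<zeta>_eq: "\<zeta> ^ a = \<zeta> ^ b \<longleftrightarrow> a mod N = b mod N" for a b
    unfolding \<zeta>_def by (rule root_of_unity_power_eq_iff[OF N_pos])
  define M where "M = range (\<lambda>a::nat. r [^] a)"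
  have idx: "index_two_subgroup G M s" and ord_r: "ord r = N"
    and conj_pow: "s \<otimes> r [^] a \<otimes> inv s = r [^] (i * a)" for a :: nat
    using index_two_subgroup_of_presentation[OF ordG k r s gen r_pow ss conj] by (auto simp: M_def N_def)
  have r_eq: "r [^] a = r [^] b \<longleftrightarrow> a mod N = b mod N" for a b :: nat
  proof -
    have "r [^] a = r [^] b \<longleftrightarrow> int N dvd int b - int a"
      using int_pow_eq[OF r, of "int a" "int b"] ord_r by (simp add: int_pow_int)
    also have "\<dots> \<longleftrightarrow> int b mod int N = int a mod int N" by (rule mod_eq_dvd_iff[symmetric])
    also have "\<dots> \<longleftrightarrow> a mod N = b mod N" by (metis of_nat_eq_iff of_nat_mod)
    finally show ?thesis .
  qed
  \<comment> \<open>Well defined on powers of \<open>r\<close>, since \<open>r\<close> and \<open>\<zeta>\<close> both have order \<open>N\<close>.\<close>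
  define \<theta> where "\<theta> x = \<zeta> ^ (SOME a. x = r [^] a)" for x
  have \<theta>_pow: "\<theta> (r [^] a) = \<zeta> ^ a" for a :: nat
  proof -
    have "r [^] a = r [^] (SOME b::nat. r [^] a = r [^] b)"
      by (rule someI[of "\<lambda>b. r [^] a = r [^] b" a]) (rule refl)
    then show ?thesis unfolding \<theta>_def using r_eq \<zeta>_eq by metis
  qed
  interpret idx: index_two_subgroup G M s by (rule idx)
  interpret ind: index_two_character G M s \<theta>
  proof (intro index_two_character.intro index_two_character_axioms.intro)
    fix x y assume "x \<in> M" "y \<in> M"
    then obtain a b :: nat where "x = r [^] a" "y = r [^] b" by (auto simp: M_def)
    then show "\<theta> (x \<otimes> y) = \<theta> x * \<theta> y" by (simp add: nat_pow_mult[OF r] \<theta>_pow power_add)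
  next
    show "\<theta> \<one> = 1" using \<theta>_pow[of 0] by simp
  qed (rule idx)
  have rM: "r \<in> M" unfolding M_def by (rule range_eqI[of _ _ 1]) (use r in simp)
  have "\<theta> r \<noteq> \<theta> (s \<otimes> r \<otimes> inv s)"
  proof
    assume "\<theta> r = \<theta> (s \<otimes> r \<otimes> inv s)"
    then have "\<zeta> ^ 1 = \<zeta> ^ i" using \<theta>_pow[of 1] \<theta>_pow[of i] r by (simp add: conj)
    then have "1 mod N mod 4 = i mod N mod 4" by (simp only: \<zeta>_eq)
    moreover have "4 dvd N" using H_even N_H by auto
    ultimately have "1 mod 4 = i mod 4" by (simp only: mod_mod_cancel)
    then show False using i by simp
  qed
  then have irr: "irreducible_representation G 2 ind.induced" by (rule ind.induced_irreducible[OF rM])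
  interpret rep: irreducible_rep G 2 ind.induced
    by (intro irreducible_rep.intro irreducible_rep_axioms.intro is_group irr)
  define Z where "Z = {g \<in> carrier G. mat_trace (ind.induced g) = 0}"
  have fin: "finite (carrier G)" by (rule finite_carrier_of_order_two_power[OF ordG])
  have lower: "2 ^ (k - 1) + 2 \<le> card Z"
    unfolding Z_def by (rule rep.zeros_of_nonlinear(1)[OF ordG]) simp
  have zero_pow: "\<zeta> ^ (i * a) = - (\<zeta> ^ a)" if "r [^] a \<in> Z" for a :: nat
  proof -
    have ext: "ind.ext (r [^] b) = \<zeta> ^ b" for b :: nat
    proof -
      have "r [^] b \<in> M" by (auto simp: M_def)
      then show ?thesis by (simp add: ind.ext_def \<theta>_pow)
    qed
    have "mat_trace (ind.induced (r [^] a)) = \<zeta> ^ a + \<zeta> ^ (i * a)"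
      using r by (simp add: ind.mat_trace_induced conj_pow ext)
    then show ?thesis using that by (simp add: Z_def add_eq_0_iff)
  qed
  have congruent: "a mod H = b mod H" if a: "r [^] a \<in> Z" and b: "r [^] b \<in> Z" for a b :: nat
  proof -
    have "\<zeta> ^ (i * a + b) = \<zeta> ^ (i * b + a)"
      using zero_pow[OF a] zero_pow[OF b] by (simp add: power_add)
    then have "(i * a + b) mod N = (i * b + a) mod N" by (simp only: \<zeta>_eq)
    then have "int (i * a + b) mod int N = int (i * b + a) mod int N" by (metis of_nat_mod)
    then have dvd: "int N dvd int (i * a + b) - int (i * b + a)" by (simp only: mod_eq_dvd_iff)
    define q where "q = i div 4"
    have "i = 4 * q + 3" using i unfolding q_def by presburger
    then have "int (i * a + b) - int (i * b + a) = 2 * ((2 * int q + 1) * (int a - int b))"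
      by (simp add: algebra_simps)
    then have "2 * int H dvd 2 * ((2 * int q + 1) * (int a - int b))" using dvd N_H by simp
    then have "int H dvd (2 * int q + 1) * (int a - int b)" by simp
    moreover have "coprime (int H) (2 * int q + 1)" by (simp add: H_def)
    ultimately have "int H dvd int a - int b" by (simp add: coprime_dvd_mult_right_iff)
    then have "int a mod int H = int b mod int H" by (simp only: mod_eq_dvd_iff)
    then show ?thesis by (metis of_nat_eq_iff of_nat_mod)
  qed
  have inside: "card (Z \<inter> M) \<le> 2"
  proof (cases "Z \<inter> M = {}")
    case False
    then obtain a0 :: nat where a0: "r [^] a0 \<in> Z" by (auto simp: M_def)
    define c where "c = a0 mod H"
    have "g \<in> {r [^] c, r [^] (c + H)}" if g: "g \<in> Z \<inter> M" for g
    proof -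
      obtain a' :: nat where "g = r [^] a'" using g by (auto simp: M_def)
      define a where "a = a' mod N"
      have ga: "g = r [^] a" using \<open>g = r [^] a'\<close> r_eq[of a' a] by (simp add: a_def)
      have "a < 2 * H" using N_pos N_H by (simp add: a_def)
      moreover have "a mod H = c" using congruent[of a a0] g ga a0 by (simp add: c_def)
      moreover have "a = H * (a div H) + a mod H" by simp
      moreover have "a div H < 2" using calculation(1) by (simp add: less_mult_imp_div_less mult.commute)
      ultimately have "a = c \<or> a = c + H" by (auto simp: less_2_cases_iff)
      then show ?thesis using ga by auto
    qed
    then have "Z \<inter> M \<subseteq> {r [^] c, r [^] (c + H)}" by blast
    then have "card (Z \<inter> M) \<le> card {r [^] c, r [^] (c + H)}" by (intro card_mono) auto
    also have "\<dots> \<le> 2" by (simp add: card_insert_if)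
    finally show ?thesis .
  qed simp
  have "Z \<subseteq> (carrier G - M) \<union> (Z \<inter> M)" by (auto simp: Z_def)
  then have "card Z \<le> card ((carrier G - M) \<union> (Z \<inter> M))"
    using fin by (intro card_mono) (auto simp: Z_def)
  also have "\<dots> \<le> card (carrier G - M) + card (Z \<inter> M)" by (rule card_Un_le)
  also have "\<dots> \<le> 2 ^ (k - 1) + 2" using idx.card_outside(2)[OF ordG] inside by simp
  finally have "card Z = 2 ^ (k - 1) + 2" using lower by simp
  moreover define \<chi> where "\<chi> = restrict (\<lambda>g. mat_trace (ind.induced g)) (carrier G)"
  have "vanishing_set G \<chi> = Z" by (auto simp: vanishing_set_def \<chi>_def Z_def)
  moreover have "\<chi> \<in> Irr G" unfolding Irr_def \<chi>_def using irr by blast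
  ultimately show ?thesis by metis
qed

text \<open>
  In the three presentations the exponent by which \<open>s\<close> acts on \<open>r\<close> is \<open>2 ^ (k - 1) - 1\<close> or
  \<open>2 ^ (k - 2) - 1\<close>; the bounds on \<open>k\<close> make it \<open>3\<close> modulo \<open>4\<close>.
\<close>

lemma exists_irr_if_dihedral_type:
  fixes G (structure)
  assumes ordG: "Coset.order G = 2 ^ n"
    and type: "dihedral_2_group G \<or> semidihedral_2_group G \<or> generalized_quaternion_group G"
  shows "\<exists>\<chi>\<in>Irr G. card (vanishing_set G \<chi>) = 2 ^ (n - 1) + 2"
proof -
  have exponent_eq: "k = n" if "Coset.order G = 2 ^ k" for k
    using that ordG by simp
  have mod4: "(2 ^ e - 1) mod 4 = (3::nat)" if "e \<ge> 2" for e :: nat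
  proof -
    from le_Suc_ex[OF that] obtain j where j: "e = 2 + j" by (elim exE)
    have "(2::nat) ^ e = 4 * 2 ^ j" by (simp add: j power_add)
    then have "(2 ^ e - 1 :: nat) = 3 + 4 * (2 ^ j - 1)" by (simp add: algebra_simps)
    then have "(2 ^ e - 1 :: nat) mod 4 = (3 + 4 * (2 ^ j - 1)) mod 4" by (simp only:)
    then show ?thesis by (simp only: mod_mult_self2) simp
  qed
  have inv_pow: "inv r = r [^] (2 ^ e - 1 :: nat)"
    if "group G" "r \<in> carrier G" "r [^] (2 ^ e :: nat) = \<one>" for r and e :: nat
  proof -
    interpret group G by fact
    have "Suc (2 ^ e - 1) = (2 ^ e :: nat)" by simp
    then have "r [^] (2 ^ e - 1 :: nat) \<otimes> r = \<one>" using that(3) by (metis nat_pow_Suc)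
    then show ?thesis using that(2) by (intro inv_equality) auto
  qed
  have square: "s [^] (2::nat) = s \<otimes> s" if "group G" "s \<in> carrier G" for s
  proof -
    interpret group G by fact
    show ?thesis using that by (simp add: numeral_2_eq_2)
  qed
  consider (D) "dihedral_2_group G" | (S) "semidihedral_2_group G" | (Q) "generalized_quaternion_group G"
    using type by blast
  then show ?thesis
  proof cases
    case D
    then obtain k r s where G: "group G" and k: "k \<ge> 3" and ordk: "Coset.order G = 2 ^ k"
      and rs: "r \<in> carrier G" "s \<in> carrier G" "generate G {r, s} = carrier G"
      and r_pow: "r [^] (2 ^ (k - 1) :: nat) = \<one>" and ss: "s [^] (2::nat) = \<one>"
      and conj: "s \<otimes> r \<otimes> inv s = inv r"
      unfolding dihedral_2_group_def by blast
    have ss': "s \<otimes> s = r [^] (0::nat)" using square[OF G rs(2)] ss by simp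
    have conj': "s \<otimes> r \<otimes> inv s = r [^] (2 ^ (k - 1) - 1 :: nat)"
      using conj inv_pow[OF G rs(1) r_pow] by simp
    have "(2 ^ (k - 1) - 1) mod 4 = (3::nat)" using k by (intro mod4) simp
    from exists_irr_with_few_zeros[OF G ordk k rs r_pow ss' conj' this]
    show ?thesis by (simp only: exponent_eq[OF ordk])
  next
    case S
    then obtain k r s where G: "group G" and k: "k \<ge> 4" and ordk: "Coset.order G = 2 ^ k"
      and rs: "r \<in> carrier G" "s \<in> carrier G" "generate G {r, s} = carrier G"
      and r_pow: "r [^] (2 ^ (k - 1) :: nat) = \<one>" and ss: "s [^] (2::nat) = \<one>"
      and conj: "s \<otimes> r \<otimes> inv s = r [^] (2 ^ (k - 2) - 1 :: nat)"
      unfolding semidihedral_2_group_def by blast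
    have ss': "s \<otimes> s = r [^] (0::nat)" using square[OF G rs(2)] ss by simp
    have k3: "k \<ge> 3" using k by simp
    have "(2 ^ (k - 2) - 1) mod 4 = (3::nat)" using k by (intro mod4) simp
    from exists_irr_with_few_zeros[OF G ordk k3 rs r_pow ss' conj this]
    show ?thesis by (simp only: exponent_eq[OF ordk])
  next
    case Q
    then obtain k r s where G: "group G" and k: "k \<ge> 3" and ordk: "Coset.order G = 2 ^ k"
      and rs: "r \<in> carrier G" "s \<in> carrier G" "generate G {r, s} = carrier G"
      and r_pow: "r [^] (2 ^ (k - 1) :: nat) = \<one>"
      and ss: "s [^] (2::nat) = r [^] (2 ^ (k - 2) :: nat)"
      and conj: "s \<otimes> r \<otimes> inv s = inv r"
      unfolding generalized_quaternion_group_def by blast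
    have ss': "s \<otimes> s = r [^] (2 ^ (k - 2) :: nat)" using square[OF G rs(2)] ss by simp
    have conj': "s \<otimes> r \<otimes> inv s = r [^] (2 ^ (k - 1) - 1 :: nat)"
      using conj inv_pow[OF G rs(1) r_pow] by simp
    have "(2 ^ (k - 1) - 1) mod 4 = (3::nat)" using k by (intro mod4) simp
    from exists_irr_with_few_zeros[OF G ordk k rs r_pow ss' conj' this]
    show ?thesis by (simp only: exponent_eq[OF ordk])
  qed
qed

theorem theoremA:
  fixes G :: "('a, 'b) monoid_scheme" and n :: nat
  assumes "group G" and "finite (carrier G)" and "Coset.order G = 2 ^ n"
  shows "(\<forall>\<chi>\<in>Irr G. \<not> linear_character G \<chi> \<longrightarrow>
            card (vanishing_set G \<chi>) \<ge> 2 ^ (n - 1) + 2) \<and>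
         ((\<exists>\<chi>\<in>Irr G. card (vanishing_set G \<chi>) = 2 ^ (n - 1) + 2) \<longleftrightarrow>
            dihedral_2_group G \<or> semidihedral_2_group G \<or> generalized_quaternion_group G)"
proof -
  have character: "(\<not> linear_character G \<chi> \<longrightarrow> card (vanishing_set G \<chi>) \<ge> 2 ^ (n - 1) + 2) \<and>
      (card (vanishing_set G \<chi>) = 2 ^ (n - 1) + 2 \<longrightarrow>
        dihedral_2_group G \<or> semidihedral_2_group G \<or> generalized_quaternion_group G)"
    if \<chi>: "\<chi> \<in> Irr G" for \<chi>
  proof -
    obtain d \<rho> where irr: "irreducible_representation G d \<rho>"
      and \<chi>_def: "\<chi> = restrict (\<lambda>g. mat_trace (\<rho> g)) (carrier G)"
      using \<chi> by (auto simp: Irr_def)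
    interpret irreducible_rep G d \<rho>
      by (intro irreducible_rep.intro irreducible_rep_axioms.intro assms(1) irr)
    have zeros: "vanishing_set G \<chi> = {g \<in> carrier G. mat_trace (\<rho> g) = 0}"
      by (auto simp: vanishing_set_def \<chi>_def)
    show ?thesis
    \<comment> \<open>Degree one is the linear case; such a character has no zeros at all, so it cannot attain the count either.\<close>
    proof (cases "d = 1")
      case True
      have "\<chi> \<one>\<^bsub>G\<^esub> = 1" using True by (simp add: \<chi>_def rho_one mat_trace_one)
      moreover have "vanishing_set G \<chi> = {}"
        unfolding zeros using trace_nonzero_if_degree_one[OF True] by blast
      ultimately show ?thesis by (simp add: linear_character_def)
    next
      case False
      show ?thesis unfolding zeros using zeros_of_nonlinear[OF assms(3) False] by blast
    qed
  qed
  then show ?thesis using exists_irr_if_dihedral_type[OF assms(3)] by blast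
qed

end
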